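(* Let $A$ be an abelian group and $X$ a pointed simplicial set. For any integer $n\ge 0$ one has the equality of $\mathfrak s$-modules $$H_n(X,HA)=H\big(H_n(X,A)\big),$$ where on the left $H_n(X,HA)$ is the homology of $X$ with coefficients in the $\mathfrak s$-module $HA$, and on the right $H_n(X,A)$ is the (reduced) abelian group homology of $X$ with coefficients in $A$. (Equality means that the two functors are canonically identified.)
   Context: $\Gamma^{\rm op}$ is the category of pointed finite sets $k_+=\{0,1,\dots,k\}$ ($k\ge 0$, base point $0$) with base-point preserving maps. An $\mathfrak s$-module (or $\Gamma$-set) is a covariant functor $M:\Gamma^{\rm op}\to \mathrm{Sets}_*$ to pointed sets which is pointed ($M(0_+)$ is a one-point set); morphisms are natural transformations. An $\mathfrak s$-module $M$ is extended to an endofunctor of $\mathrm{Sets}_*$ by taking the filtered colimit over finite pointed subsets. For a pointed simplicial set $X$, $M\circ X$ is the pointed simplicial set $[q]\mapsto M(X_q)$. For a commutative monoid $A$ with zero $0$, $HA$ is the $\mathfrak s$-module $HA(k_+)=A^k$, with, for $f:k_+\to n_+$ in $\Gamma^{\rm op}$, $HA(f)(m)(j)=\sum_{f(\ell)=j}m_\ell$ for $1\le j\le n$ (empty sum $=0$). For a pointed simplicial set $Y$ with base point $*$ (in every degree) and faces $\partial_j$, and $n\ge 0$, let $Z_n(Y)=\{x\in Y_n\mid \partial_j x=*\ \forall j\}$ (for $n=0$ the condition is vacuous). On $Z_n(Y)$ consider the relation $xRy$ iff there exists $z\in Y_{n+1}$ with $\partial_j z=*$ for all $j<n$, $\partial_n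 z=x$ and $\partial_{n+1}z=y$. Define $\pi_n^{\rm comb}(Y)$ as the quotient of $Z_n(Y)$ by the equivalence relation generated by $R$, pointed by the class of $*$. For a pointed simplicial set $X$ and an $\mathfrak s$-module $M$, the homology $H_n(X,M)$ is the $\mathfrak s$-module $$H_n(X,M)(k_+):=\pi_n^{\rm comb}\big(M\circ (X\wedge k_+)\big),$$ where $k_+$ is viewed as a constant pointed simplicial set. *)

theory Defs
  imports "HOL-Algebra.Coset" "HOL-Algebra.FiniteProduct"
begin

section \<open>Pointed sets and Gamma-sets\<close>

record 'a pset = "'a partial_object" +
  point :: 'a

definition pointed_set :: "'a pset \<Rightarrow> bool" where
  "pointed_set S \<longleftrightarrow> point S \<in> carrier S"

definition pointed_map :: "'a pset \<Rightarrow> 'b pset \<Rightarrow> ('a \<Rightarrow> 'b) \<Rightarrow> bool" where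
  "pointed_map S T f \<longleftrightarrow> f \<in> carrier S \<rightarrow> carrier T \<and> f (point S) = point T"

definition fin_pset :: "nat \<Rightarrow> nat pset" where
  "fin_pset k = \<lparr>carrier = {0..k}, point = 0\<rparr>"

text \<open>In \<open>arr M k l f\<close>, the function \<open>f\<close> stands for the arrow \<open>k\<^sub>+ \<rightarrow> l\<^sub>+\<close> given by its restriction to
  \<open>{0..k}\<close>; the axiom \<open>arr_cong\<close> makes this legitimate. Likewise only the restriction of \<open>arr M k l f\<close>
  to the carrier of \<open>obj M k\<close> is meaningful.\<close>

record 'm gamma =
  obj :: "nat \<Rightarrow> 'm pset"
  arr :: "nat \<Rightarrow> nat \<Rightarrow> (nat \<Rightarrow> nat) \<Rightarrow> 'm \<Rightarrow> 'm"

locale gamma_set =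
  fixes M :: "'m gamma"
  assumes obj_pointed: "pointed_set (obj M k)"
    and obj_zero: "carrier (obj M 0) = {point (obj M 0)}"
    and arr_pointed:
      "pointed_map (fin_pset k) (fin_pset l) f \<Longrightarrow> pointed_map (obj M k) (obj M l) (arr M k l f)"
    and arr_cong:
      "\<lbrakk>pointed_map (fin_pset k) (fin_pset l) f; \<forall>i\<in>{0..k}. f i = g i; m \<in> carrier (obj M k)\<rbrakk>
        \<Longrightarrow> arr M k l f m = arr M k l g m"
    and arr_id: "m \<in> carrier (obj M k) \<Longrightarrow> arr M k k id m = m"
    and arr_comp:
      "\<lbrakk>pointed_map (fin_pset k) (fin_pset l) f; pointed_map (fin_pset l) (fin_pset p) g;
        m \<in> carrier (obj M k)\<rbrakk> \<Longrightarrow> arr M k p (g \<circ> f) m = arr M l p g (arr M k l f m)"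

definition gamma_iso :: "'m gamma \<Rightarrow> 'n gamma \<Rightarrow> (nat \<Rightarrow> 'm \<Rightarrow> 'n) \<Rightarrow> bool" where
  "gamma_iso M N \<eta> \<longleftrightarrow>
     gamma_set M \<and> gamma_set N \<and>
     (\<forall>k. pointed_map (obj M k) (obj N k) (\<eta> k) \<and>
          bij_betw (\<eta> k) (carrier (obj M k)) (carrier (obj N k))) \<and>
     (\<forall>k l f. pointed_map (fin_pset k) (fin_pset l) f \<longrightarrow>
        (\<forall>m\<in>carrier (obj M k). \<eta> l (arr M k l f m) = arr N k l f (\<eta> k m)))"

text \<open>The Gamma-set \<open>HA\<close> of a commutative monoid, which is written multiplicatively as usual in
  HOL-Algebra; \<open>A\<^sup>k\<close> is the set of extensional functions on \<open>{1..k}\<close>.\<close>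

definition EM :: "('a, 'b) monoid_scheme \<Rightarrow> (nat \<Rightarrow> 'a) gamma" where
  "EM A =
     \<lparr>obj = (\<lambda>k. \<lparr>carrier = {1..k} \<rightarrow>\<^sub>E carrier A, point = (\<lambda>j\<in>{1..k}. \<one>\<^bsub>A\<^esub>)\<rparr>),
      arr = (\<lambda>k l f m. \<lambda>j\<in>{1..l}. \<Otimes>\<^bsub>A\<^esub>i\<in>{i\<in>{1..k}. f i = j}. m i)\<rparr>"


section \<open>Extension of a Gamma-set to pointed sets\<close>

text \<open>A finite pointed set \<open>F\<close> with \<open>k + 1\<close> elements is identified with \<open>k\<^sub>+\<close> by a chosen pointed
  bijection \<open>enum F\<close>; this extends a Gamma-set from the objects \<open>k\<^sub>+\<close> to all finite pointed sets.\<close>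

definition rank :: "'s pset \<Rightarrow> nat" where
  "rank F = card (carrier F) - 1"

definition enum :: "'s pset \<Rightarrow> nat \<Rightarrow> 's" where
  "enum F = (SOME e. bij_betw e {0..rank F} (carrier F) \<and> e 0 = point F)"

definition index :: "'s pset \<Rightarrow> 's \<Rightarrow> nat" where
  "index F = inv_into {0..rank F} (enum F)"

definition fin_obj :: "'m gamma \<Rightarrow> 's pset \<Rightarrow> 'm pset" where
  "fin_obj M F = obj M (rank F)"

definition fin_arr :: "'m gamma \<Rightarrow> 's pset \<Rightarrow> 't pset \<Rightarrow> ('s \<Rightarrow> 't) \<Rightarrow> 'm \<Rightarrow> 'm" where
  "fin_arr M F G \<phi> = arr M (rank F) (rank G) (index G \<circ> \<phi> \<circ> enum F)"

definition sub :: "'s pset \<Rightarrow> 's set \<Rightarrow> 's pset" where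
  "sub S F = \<lparr>carrier = F, point = point S\<rparr>"

definition fin_subs :: "'s pset \<Rightarrow> 's set set" where
  "fin_subs S = {F. finite F \<and> point S \<in> F \<and> F \<subseteq> carrier S}"

text \<open>The filtered colimit of \<open>M(F)\<close> over the finite pointed subsets \<open>F\<close> of \<open>S\<close>: pairs \<open>(F, m)\<close> with
  \<open>m \<in> M(F)\<close>, two of them being identified when they become equal in \<open>M(H)\<close> for some larger \<open>H\<close>.\<close>

definition ext_elts :: "'m gamma \<Rightarrow> 's pset \<Rightarrow> ('s set \<times> 'm) set" where
  "ext_elts M S = (SIGMA F:fin_subs S. carrier (fin_obj M (sub S F)))"

definition ext_rel :: "'m gamma \<Rightarrow> 's pset \<Rightarrow> (('s set \<times> 'm) \<times> ('s set \<times> 'm)) set" where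
  "ext_rel M S = {((F, m), (G, n)).
     (F, m) \<in> ext_elts M S \<and> (G, n) \<in> ext_elts M S \<and>
     (\<exists>H\<in>fin_subs S. F \<subseteq> H \<and> G \<subseteq> H \<and>
        fin_arr M (sub S F) (sub S H) id m = fin_arr M (sub S G) (sub S H) id n)}"

definition ext_obj :: "'m gamma \<Rightarrow> 's pset \<Rightarrow> ('s set \<times> 'm) set pset" where
  "ext_obj M S =
     \<lparr>carrier = ext_elts M S // ext_rel M S,
      point = ext_rel M S `` {({point S}, point (fin_obj M (sub S {point S})))}\<rparr>"

text \<open>The value on a class is formed from all its representatives at once, so that no choice of a
  representative is involved.\<close>

definition ext_arr :: "'m gamma \<Rightarrow> 's pset \<Rightarrow> 't pset \<Rightarrow> ('s \<Rightarrow> 't) \<Rightarrow>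
    ('s set \<times> 'm) set \<Rightarrow> ('t set \<times> 'm) set" where
  "ext_arr M S T \<phi> u =
     ext_rel M T `` ((\<lambda>(F, m). (\<phi> ` F, fin_arr M (sub S F) (sub T (\<phi> ` F)) \<phi> m)) ` u)"


section \<open>Pointed simplicial sets\<close>

text \<open>\<open>face X n i\<close> is the face \<open>X\<^sub>n \<rightarrow> X\<^sub>n\<^sub>-\<^sub>1\<close> (for \<open>n \<ge> 1\<close>) and \<open>degen X n i\<close> the degeneracy
  \<open>X\<^sub>n \<rightarrow> X\<^sub>n\<^sub>+\<^sub>1\<close>.\<close>

record 'x psset =
  simp :: "nat \<Rightarrow> 'x pset"
  face :: "nat \<Rightarrow> nat \<Rightarrow> 'x \<Rightarrow> 'x"
  degen :: "nat \<Rightarrow> nat \<Rightarrow> 'x \<Rightarrow> 'x"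

locale pointed_simplicial_set =
  fixes X :: "'x psset"
  assumes simp_pointed: "pointed_set (simp X n)"
    and face_pointed: "i \<le> Suc n \<Longrightarrow> pointed_map (simp X (Suc n)) (simp X n) (face X (Suc n) i)"
    and degen_pointed: "i \<le> n \<Longrightarrow> pointed_map (simp X n) (simp X (Suc n)) (degen X n i)"
    and face_face: "\<lbrakk>i < j; j \<le> n + 2; x \<in> carrier (simp X (n + 2))\<rbrakk> \<Longrightarrow>
      face X (n + 1) i (face X (n + 2) j x) = face X (n + 1) (j - 1) (face X (n + 2) i x)"
    and face_degen_less: "\<lbrakk>i < j; j \<le> n; x \<in> carrier (simp X n)\<rbrakk> \<Longrightarrow>
      face X (n + 1) i (degen X n j x) = degen X (n - 1) (j - 1) (face X n i x)"
    and face_degen_same: "\<lbrakk>i = j \<or> i = j + 1; j \<le> n; x \<in> carrier (simp X n)\<rbrakk> \<Longrightarrow>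
      face X (n + 1) i (degen X n j x) = x"
    and face_degen_greater: "\<lbrakk>j + 1 < i; i \<le> n + 1; x \<in> carrier (simp X n)\<rbrakk> \<Longrightarrow>
      face X (n + 1) i (degen X n j x) = degen X (n - 1) j (face X n (i - 1) x)"
    and degen_degen: "\<lbrakk>i \<le> j; j \<le> n; x \<in> carrier (simp X n)\<rbrakk> \<Longrightarrow>
      degen X (n + 1) i (degen X n j x) = degen X (n + 1) (j + 1) (degen X n i x)"

definition const_psset :: "'t pset \<Rightarrow> 't psset" where
  "const_psset T = \<lparr>simp = (\<lambda>_. T), face = (\<lambda>_ _. id), degen = (\<lambda>_ _. id)\<rparr>"

text \<open>The quotient \<open>(S \<times> T) / (S \<or> T)\<close>, represented by the pairs with no coordinate at a base point
  together with the pair of base points.\<close>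

definition smash :: "'s pset \<Rightarrow> 't pset \<Rightarrow> ('s \<times> 't) pset" where
  "smash S T =
     \<lparr>carrier = insert (point S, point T) ((carrier S - {point S}) \<times> (carrier T - {point T})),
      point = (point S, point T)\<rparr>"

definition smash_map :: "'s pset \<Rightarrow> 't pset \<Rightarrow> ('u \<Rightarrow> 's) \<Rightarrow> ('v \<Rightarrow> 't) \<Rightarrow> 'u \<times> 'v \<Rightarrow> 's \<times> 't" where
  "smash_map S T \<phi> \<psi> = (\<lambda>(x, y).
     if \<phi> x = point S \<or> \<psi> y = point T then (point S, point T) else (\<phi> x, \<psi> y))"

definition smash_psset :: "'x psset \<Rightarrow> 'y psset \<Rightarrow> ('x \<times> 'y) psset" where
  "smash_psset X Y =
     \<lparr>simp = (\<lambda>n. smash (simp X n) (simp Y n)),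
      face = (\<lambda>n i. smash_map (simp X (n - 1)) (simp Y (n - 1)) (face X n i) (face Y n i)),
      degen = (\<lambda>n i. smash_map (simp X (n + 1)) (simp Y (n + 1)) (degen X n i) (degen Y n i))\<rparr>"

definition compose_psset :: "'m gamma \<Rightarrow> 'x psset \<Rightarrow> ('x set \<times> 'm) set psset" where
  "compose_psset M X =
     \<lparr>simp = (\<lambda>n. ext_obj M (simp X n)),
      face = (\<lambda>n i. ext_arr M (simp X n) (simp X (n - 1)) (face X n i)),
      degen = (\<lambda>n i. ext_arr M (simp X n) (simp X (n + 1)) (degen X n i))\<rparr>"


section \<open>Combinatorial homotopy and homology of a Gamma-set\<close>

definition Zcomb :: "nat \<Rightarrow> 'y psset \<Rightarrow> 'y set" where
  "Zcomb n Y = {x \<in> carrier (simp Y n). n = 0 \<or> (\<forall>j\<le>n. face Y n j x = point (simp Y (n - 1)))}"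

definition Rcomb :: "nat \<Rightarrow> 'y psset \<Rightarrow> 'y \<Rightarrow> 'y \<Rightarrow> bool" where
  "Rcomb n Y x y \<longleftrightarrow> x \<in> Zcomb n Y \<and> y \<in> Zcomb n Y \<and>
     (\<exists>z\<in>carrier (simp Y (n + 1)).
        (\<forall>j<n. face Y (n + 1) j z = point (simp Y n)) \<and>
        face Y (n + 1) n z = x \<and> face Y (n + 1) (n + 1) z = y)"

definition Ecomb :: "nat \<Rightarrow> 'y psset \<Rightarrow> ('y \<times> 'y) set" where
  "Ecomb n Y = {(x, y). x \<in> Zcomb n Y \<and> y \<in> Zcomb n Y \<and> equivclp (Rcomb n Y) x y}"

definition pi_comb :: "nat \<Rightarrow> 'y psset \<Rightarrow> 'y set pset" where
  "pi_comb n Y =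
     \<lparr>carrier = Zcomb n Y // Ecomb n Y, point = Ecomb n Y `` {point (simp Y n)}\<rparr>"

definition pi_comb_map :: "nat \<Rightarrow> 'z psset \<Rightarrow> ('y \<Rightarrow> 'z) \<Rightarrow> 'y set \<Rightarrow> 'z set" where
  "pi_comb_map n Y' g c = Ecomb n Y' `` (g ` c)"

definition smash_fin :: "'x psset \<Rightarrow> nat \<Rightarrow> ('x \<times> nat) psset" where
  "smash_fin X k = smash_psset X (const_psset (fin_pset k))"

definition gamma_homology ::
    "nat \<Rightarrow> 'x psset \<Rightarrow> 'm gamma \<Rightarrow> (('x \<times> nat) set \<times> 'm) set set gamma" where
  "gamma_homology n X M =
     \<lparr>obj = (\<lambda>k. pi_comb n (compose_psset M (smash_fin X k))),
      arr = (\<lambda>k l f. pi_comb_map n (compose_psset M (smash_fin X l))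
         (ext_arr M (simp (smash_fin X k) n) (simp (smash_fin X l) n)
            (smash_map (simp X n) (fin_pset l) id f)))\<rparr>"


section \<open>Reduced homology with coefficients in an abelian group\<close>

text \<open>The reduced chain group \<open>A[X\<^sub>n] / A[*]\<close>: finitely supported functions on the simplices other
  than the base point, with the alternating sum of the faces as boundary (all written
  multiplicatively).\<close>

definition chain_group :: "nat \<Rightarrow> 'x psset \<Rightarrow> ('a, 'b) monoid_scheme \<Rightarrow> ('x \<Rightarrow> 'a) monoid" where
  "chain_group n X A =
     \<lparr>carrier = {c. (\<forall>x. c x \<in> carrier A) \<and> finite {x. c x \<noteq> \<one>\<^bsub>A\<^esub>} \<and>
                    {x. c x \<noteq> \<one>\<^bsub>A\<^esub>} \<subseteq> carrier (simp X n) - {point (simp X n)}},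
      monoid.mult = (\<lambda>c d x. c x \<otimes>\<^bsub>A\<^esub> d x),
      one = (\<lambda>x. \<one>\<^bsub>A\<^esub>)\<rparr>"

text \<open>Restricting the product to the support of the chain matters, since \<open>finprod\<close> is trivial on
  infinite index sets.\<close>

definition push_chain :: "('a, 'b) monoid_scheme \<Rightarrow> 't pset \<Rightarrow> ('s \<Rightarrow> 't) \<Rightarrow> ('s \<Rightarrow> 'a) \<Rightarrow> 't \<Rightarrow> 'a"
  where
  "push_chain A T \<phi> c y =
     (if y = point T then \<one>\<^bsub>A\<^esub> else \<Otimes>\<^bsub>A\<^esub>x\<in>{x. c x \<noteq> \<one>\<^bsub>A\<^esub> \<and> \<phi> x = y}. c x)"

definition chain_boundary ::
    "nat \<Rightarrow> 'x psset \<Rightarrow> ('a, 'b) monoid_scheme \<Rightarrow> ('x \<Rightarrow> 'a) \<Rightarrow> 'x \<Rightarrow> 'a" where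
  "chain_boundary n X A c y =
     (\<Otimes>\<^bsub>A\<^esub>i\<in>{0..n}. push_chain A (simp X (n - 1)) (face X n i) c y [^]\<^bsub>A\<^esub> ((- 1 :: int) ^ i))"

definition cycles :: "nat \<Rightarrow> 'x psset \<Rightarrow> ('a, 'b) monoid_scheme \<Rightarrow> ('x \<Rightarrow> 'a) set" where
  "cycles n X A =
     {c \<in> carrier (chain_group n X A).
        n = 0 \<or> chain_boundary n X A c = \<one>\<^bsub>chain_group (n - 1) X A\<^esub>}"

definition boundaries :: "nat \<Rightarrow> 'x psset \<Rightarrow> ('a, 'b) monoid_scheme \<Rightarrow> ('x \<Rightarrow> 'a) set" where
  "boundaries n X A = chain_boundary (n + 1) X A ` carrier (chain_group (n + 1) X A)"

definition reduced_homology ::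
    "nat \<Rightarrow> 'x psset \<Rightarrow> ('a, 'b) monoid_scheme \<Rightarrow> ('x \<Rightarrow> 'a) set monoid" where
  "reduced_homology n X A = (chain_group n X A)\<lparr>carrier := cycles n X A\<rparr> Mod boundaries n X A"


section \<open>The canonical map\<close>

text \<open>An element \<open>u\<close> of the extension of \<open>HA\<close> to \<open>S\<close> is a formal combination of the elements of \<open>S\<close>
  other than the base point; \<open>coefficient A S u s\<close> is the coefficient of \<open>s\<close>, which does not depend on
  the representative of \<open>u\<close>.\<close>

definition coefficient ::
    "('a, 'b) monoid_scheme \<Rightarrow> 's pset \<Rightarrow> ('s set \<times> (nat \<Rightarrow> 'a)) set \<Rightarrow> 's \<Rightarrow> 'a" where
  "coefficient A S u s =
     (case (SOME r. r \<in> u) of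
        (F, m) \<Rightarrow> if s \<in> F - {point S} then m (index (sub S F) s) else \<one>\<^bsub>A\<^esub>)"

definition component ::
    "nat \<Rightarrow> 'x psset \<Rightarrow> ('a, 'b) monoid_scheme \<Rightarrow> nat \<Rightarrow> nat \<Rightarrow>
     (('x \<times> nat) set \<times> (nat \<Rightarrow> 'a)) set \<Rightarrow> 'x \<Rightarrow> 'a" where
  "component n X A k j u = (\<lambda>x. coefficient A (simp (smash_fin X k) n) u (x, j))"

text \<open>The class of \<open>u\<close> in \<open>\<pi>\<^sub>n(HA \<circ> (X \<and> k\<^sub>+))\<close> is sent to the \<open>k\<close>-tuple of the homology classes of its
  components. The product of the boundaries with the set of components of all representatives of \<open>c\<close>
  is a single coset of the boundaries.\<close>

definition canonical_map ::
    "nat \<Rightarrow> 'x psset \<Rightarrow> ('a, 'b) monoid_scheme \<Rightarrow> nat \<Rightarrow>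
     (('x \<times> nat) set \<times> (nat \<Rightarrow> 'a)) set set \<Rightarrow> nat \<Rightarrow> ('x \<Rightarrow> 'a) set" where
  "canonical_map n X A k c =
     (\<lambda>j\<in>{1..k}. boundaries n X A <#>\<^bsub>chain_group n X A\<^esub> (component n X A k j ` c))"

end

theory Submission
  imports Defs
begin

text \<open>An element of \<open>HA(S)\<close> is a reduced chain on the pointed set \<open>S\<close>, naturally in \<open>S\<close>, and a reduced
  chain on \<open>X\<^sub>n \<and> k\<^sub>+\<close> is a \<open>k\<close>-tuple of reduced chains on \<open>X\<^sub>n\<close>. So \<open>HA \<circ> (X \<and> k\<^sub>+)\<close> is the \<open>k\<close>-th power
  of the simplicial abelian group of reduced chains on \<open>X\<close>, and its combinatorial homotopy is the
  homology of the normalized (Moore) complex. That this agrees with the homology of the alternating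
  face complex is shown on elements, killing one face after the other by passing from \<open>x\<close> to
  \<open>x - s\<^sub>p d\<^sub>p x\<close>.\<close>


section \<open>Normalization for simplicial abelian groups\<close>

text \<open>Two obstacles shape the argument. The relation \<open>R\<close> of a general pointed
  simplicial set need not be an equivalence; here the group structure takes the place of horn
  filling. If \<open>w\<close> has boundary \<open>x - y\<close> and only its last face is
  nontrivial, then, after a change of sign of \<open>w\<close>, the two top faces of
  \<open>w + s_n x\<close> are \<open>x\<close> and \<open>y\<close>, so a single step of
  \<open>R\<close> already says that \<open>x\<close> and \<open>y\<close> are homologous. Faces are
  killed from the bottom upwards because, once those below \<open>p\<close> vanish,
  \<open>bd (s_p x) + s_p (bd x) = (-1)^p s_p d_p x\<close>, which makes the correction of a cycle a
  boundary, and because \<open>d_j s_p d_p = s_{p-1} d_{p-1} d_j\<close> for \<open>j < p\<close>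
  preserves what has been achieved. The other obstacle is that elements of the extension of
  \<open>HA\<close> are classes of pairs built from chosen enumerations of finite sets. They are
  replaced by their coefficient functions, which do not see the choices; the simplicial identities
  are then verified for chains on \<open>X\<close> only.\<close>

lemma comm_group_hom_finprod:
  assumes "comm_group G" "comm_group H" "h \<in> hom G H" "f \<in> I \<rightarrow> carrier G"
  shows "h (finprod G f I) = finprod H (\<lambda>i. h (f i)) I"
proof -
  interpret G: comm_group G by fact
  interpret H: comm_group H by fact
  interpret group_hom G H h using assms(3) by unfold_locales
  show ?thesis using assms(4)
  \<comment> \<open>An infinite index set is allowed: both products are then the unit by default,
    and \<open>h\<close> preserves it.\<close>
  proof (induction I rule: infinite_finite_induct)
    case (insert i I)
    then have "f i \<in> carrier G" "f \<in> I \<rightarrow> carrier G" "(\<lambda>i. h (f i)) \<in> I \<rightarrow> carrier H"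
      by (auto simp: Pi_iff)
    with insert show ?case by simp
  qed simp_all
qed

text \<open>Inversion is an endomorphism of an abelian group, so it commutes with products like any
  homomorphism.\<close>

lemma (in comm_group) finprod_inv:
  assumes "f \<in> I \<rightarrow> carrier G"
  shows "(\<Otimes>i\<in>I. inv (f i)) = inv (finprod G f I)"
proof -
  have "(\<lambda>x. inv x) \<in> hom G G" by (auto simp: hom_def inv_mult)
  from comm_group_hom_finprod[OF _ _ this assms] show ?thesis
    by (simp add: comm_group_axioms)
qed

text \<open>Turns the iterated sum in \<open>bd (bd x)\<close> into a sum over pairs of indices,
  where the terms can be matched.\<close>

lemma (in comm_monoid) finprod_finprod:
  assumes "finite I" "finite J" "\<And>i j. \<lbrakk>i \<in> I; j \<in> J\<rbrakk> \<Longrightarrow> f i j \<in> carrier G"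
  shows "(\<Otimes>i\<in>I. \<Otimes>j\<in>J. f i j) = (\<Otimes>p\<in>I \<times> J. f (fst p) (snd p))"
proof -
  have "I \<times> J = (\<Union>i\<in>I. Pair i ` J)" by auto
  moreover have "finprod G (\<lambda>p. f (fst p) (snd p)) (\<Union>i\<in>I. Pair i ` J) =
      (\<Otimes>i\<in>I. finprod G (\<lambda>p. f (fst p) (snd p)) (Pair i ` J))"
    using assms by (intro finprod_UN_disjoint) (auto simp: pairwise_def disjnt_def)
  moreover have "\<dots> = (\<Otimes>i\<in>I. \<Otimes>j\<in>J. f i j)"
  proof (rule finprod_cong')
    show "finprod G (\<lambda>p. f (fst p) (snd p)) (Pair i ` J) = (\<Otimes>j\<in>J. f i j)" if "i \<in> I" for i
      using assms that by (subst finprod_reindex) (auto simp: inj_on_def)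
  qed (use assms in auto)
  ultimately show ?thesis by simp
qed

lemma comm_group_hom_int_pow:
  assumes "comm_group G" "comm_group H" "h \<in> hom G H" "x \<in> carrier G"
  shows "h (x [^]\<^bsub>G\<^esub> (z :: int)) = h x [^]\<^bsub>H\<^esub> z"
proof -
  interpret group_hom G H h
    using assms by (simp add: group_hom_def group_hom_axioms_def comm_group_def)
  show ?thesis using assms by (simp add: hom_int_pow)
qed

text \<open>The simplicial identities are written with successors, for instance
  \<open>d_i d_{j+1} = d_j d_i\<close> for \<open>i \<le> j\<close>, to keep truncated subtraction
  out of the index calculations.\<close>

locale simplicial_comm_group =
  fixes G :: "nat \<Rightarrow> ('g, 'c) monoid_scheme" and d s :: "nat \<Rightarrow> nat \<Rightarrow> 'g \<Rightarrow> 'g"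
  assumes comm_group: "comm_group (G n)"
    and d_hom: "i \<le> Suc n \<Longrightarrow> d (Suc n) i \<in> hom (G (Suc n)) (G n)"
    and s_hom: "i \<le> n \<Longrightarrow> s n i \<in> hom (G n) (G (Suc n))"
    and d_d: "\<lbrakk>i \<le> j; j \<le> Suc n; x \<in> carrier (G (Suc (Suc n)))\<rbrakk> \<Longrightarrow>
      d (Suc n) i (d (Suc (Suc n)) (Suc j) x) = d (Suc n) j (d (Suc (Suc n)) i x)"
    and d_s_less: "\<lbrakk>i \<le> j; j \<le> n; x \<in> carrier (G (Suc n))\<rbrakk> \<Longrightarrow>
      d (Suc (Suc n)) i (s (Suc n) (Suc j) x) = s n j (d (Suc n) i x)"
    and d_s_same: "\<lbrakk>i = j \<or> i = Suc j; j \<le> n; x \<in> carrier (G n)\<rbrakk> \<Longrightarrow> d (Suc n) i (s n j x) = x"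
    and d_s_greater: "\<lbrakk>j < i; i \<le> Suc n; x \<in> carrier (G (Suc n))\<rbrakk> \<Longrightarrow>
      d (Suc (Suc n)) (Suc i) (s (Suc n) j x) = s n j (d (Suc n) i x)"
begin

text \<open>The sign \<open>(-1)^i\<close> in multiplicative notation. It stays an integer power so
  that \<open>bd\<close> agrees with \<open>chain_boundary\<close>; \<open>alt_cases\<close> reduces
  it to the parity of \<open>i\<close>.\<close>

definition alt :: "nat \<Rightarrow> nat \<Rightarrow> 'g \<Rightarrow> 'g" where
  "alt n i x = x [^]\<^bsub>G n\<^esub> ((- 1 :: int) ^ i)"

definition bd :: "nat \<Rightarrow> 'g \<Rightarrow> 'g" where
  "bd n x = (\<Otimes>\<^bsub>G (n - 1)\<^esub>i\<in>{0..n}. alt (n - 1) i (d n i x))"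

lemma comm_monoid [simp]: "comm_monoid (G n)" and monoid [simp]: "monoid (G n)"
  and group [simp]: "Group.group (G n)"
  using comm_group[of n] by (auto simp: comm_group_def group_def)

lemmas [simp] = comm_group

lemma m_closed [simp]: "\<lbrakk>x \<in> carrier (G n); y \<in> carrier (G n)\<rbrakk> \<Longrightarrow> x \<otimes>\<^bsub>G n\<^esub> y \<in> carrier (G n)"
  by (rule monoid.m_closed) simp_all

lemma inv_closed [simp]: "x \<in> carrier (G n) \<Longrightarrow> inv\<^bsub>G n\<^esub> x \<in> carrier (G n)"
  by (rule group.inv_closed) simp_all

lemma one_closed [simp]: "\<one>\<^bsub>G n\<^esub> \<in> carrier (G n)"
  by (rule monoid.one_closed) simp

lemma inv_one [simp]: "inv\<^bsub>G n\<^esub> \<one>\<^bsub>G n\<^esub> = \<one>\<^bsub>G n\<^esub>"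
  by (rule monoid.inv_one) simp

lemma r_one [simp]: "x \<in> carrier (G n) \<Longrightarrow> x \<otimes>\<^bsub>G n\<^esub> \<one>\<^bsub>G n\<^esub> = x"
  by (rule monoid.r_one) simp_all

lemma d_closed [simp]: "\<lbrakk>i \<le> Suc n; x \<in> carrier (G (Suc n))\<rbrakk> \<Longrightarrow> d (Suc n) i x \<in> carrier (G n)"
  using d_hom by (auto simp: hom_def)

lemma s_closed [simp]: "\<lbrakk>i \<le> n; x \<in> carrier (G n)\<rbrakk> \<Longrightarrow> s n i x \<in> carrier (G (Suc n))"
  using s_hom by (auto simp: hom_def)

lemma d_mult [simp]: "\<lbrakk>i \<le> Suc n; x \<in> carrier (G (Suc n)); y \<in> carrier (G (Suc n))\<rbrakk> \<Longrightarrow>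
    d (Suc n) i (x \<otimes>\<^bsub>G (Suc n)\<^esub> y) = d (Suc n) i x \<otimes>\<^bsub>G n\<^esub> d (Suc n) i y"
  using d_hom by (auto simp: hom_def)

lemma s_mult [simp]: "\<lbrakk>i \<le> n; x \<in> carrier (G n); y \<in> carrier (G n)\<rbrakk> \<Longrightarrow>
    s n i (x \<otimes>\<^bsub>G n\<^esub> y) = s n i x \<otimes>\<^bsub>G (Suc n)\<^esub> s n i y"
  using s_hom by (auto simp: hom_def)

lemma d_group_hom: "i \<le> Suc n \<Longrightarrow> group_hom (G (Suc n)) (G n) (d (Suc n) i)"
  by (simp add: group_hom_def group_hom_axioms_def d_hom)

lemma s_group_hom: "i \<le> n \<Longrightarrow> group_hom (G n) (G (Suc n)) (s n i)"
  by (simp add: group_hom_def group_hom_axioms_def s_hom)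

lemma d_one [simp]: "i \<le> Suc n \<Longrightarrow> d (Suc n) i \<one>\<^bsub>G (Suc n)\<^esub> = \<one>\<^bsub>G n\<^esub>"
  by (rule group_hom.hom_one[OF d_group_hom])

lemma s_one [simp]: "i \<le> n \<Longrightarrow> s n i \<one>\<^bsub>G n\<^esub> = \<one>\<^bsub>G (Suc n)\<^esub>"
  by (rule group_hom.hom_one[OF s_group_hom])

lemma d_inv [simp]: "\<lbrakk>i \<le> Suc n; x \<in> carrier (G (Suc n))\<rbrakk> \<Longrightarrow>
    d (Suc n) i (inv\<^bsub>G (Suc n)\<^esub> x) = inv\<^bsub>G n\<^esub> d (Suc n) i x"
  by (rule group_hom.hom_inv[OF d_group_hom])

lemma s_inv [simp]: "\<lbrakk>i \<le> n; x \<in> carrier (G n)\<rbrakk> \<Longrightarrow>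
    s n i (inv\<^bsub>G n\<^esub> x) = inv\<^bsub>G (Suc n)\<^esub> s n i x"
  by (rule group_hom.hom_inv[OF s_group_hom])

lemma alt_closed [simp]: "x \<in> carrier (G n) \<Longrightarrow> alt n i x \<in> carrier (G n)"
  by (simp add: alt_def group.int_pow_closed)

lemma alt_one [simp]: "alt n i \<one>\<^bsub>G n\<^esub> = \<one>\<^bsub>G n\<^esub>"
  by (simp add: alt_def group.int_pow_one)

lemma alt_cases: "x \<in> carrier (G n) \<Longrightarrow> alt n i x = (if even i then x else inv\<^bsub>G n\<^esub> x)"
  by (cases "even i") (auto simp: alt_def group.int_pow_neg group.int_pow_1)

lemma d_alt [simp]: "\<lbrakk>i \<le> Suc n; x \<in> carrier (G (Suc n))\<rbrakk> \<Longrightarrow>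
    d (Suc n) i (alt (Suc n) j x) = alt n j (d (Suc n) i x)"
  by (simp add: alt_cases)

lemma s_alt [simp]: "\<lbrakk>i \<le> n; x \<in> carrier (G n)\<rbrakk> \<Longrightarrow>
    s n i (alt n j x) = alt (Suc n) j (s n i x)"
  by (simp add: alt_cases)

lemma alt_mult [simp]: "\<lbrakk>x \<in> carrier (G n); y \<in> carrier (G n)\<rbrakk> \<Longrightarrow>
    alt n i (x \<otimes>\<^bsub>G n\<^esub> y) = alt n i x \<otimes>\<^bsub>G n\<^esub> alt n i y"
  by (simp add: alt_cases comm_group.inv_mult)

lemma alt_Suc: "x \<in> carrier (G n) \<Longrightarrow> alt n (Suc i) x = inv\<^bsub>G n\<^esub> alt n i x"
  by (simp add: alt_cases)

lemma alt_alt [simp]: "x \<in> carrier (G n) \<Longrightarrow> alt n i (alt n i x) = x"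
  by (simp add: alt_cases)

lemma inv_alt: "x \<in> carrier (G n) \<Longrightarrow> inv\<^bsub>G n\<^esub> alt n i x = alt n i (inv\<^bsub>G n\<^esub> x)"
  by (simp add: alt_cases)

section \<open>The alternating face complex\<close>

lemma bd_Suc: "bd (Suc n) x = (\<Otimes>\<^bsub>G n\<^esub>i\<in>{0..Suc n}. alt n i (d (Suc n) i x))"
  by (simp add: bd_def)

lemma bd_hom: "bd (Suc n) \<in> hom (G (Suc n)) (G n)"
proof (rule homI)
  interpret comm_group "G n" by simp
  show "bd (Suc n) x \<in> carrier (G n)" if "x \<in> carrier (G (Suc n))" for x
    using that unfolding bd_Suc by (intro finprod_closed) auto
  show "bd (Suc n) (x \<otimes>\<^bsub>G (Suc n)\<^esub> y) = bd (Suc n) x \<otimes>\<^bsub>G n\<^esub> bd (Suc n) y"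
    if "x \<in> carrier (G (Suc n))" "y \<in> carrier (G (Suc n))" for x y
  proof -
    have "bd (Suc n) (x \<otimes>\<^bsub>G (Suc n)\<^esub> y) =
        (\<Otimes>\<^bsub>G n\<^esub>i\<in>{0..Suc n}. alt n i (d (Suc n) i x) \<otimes>\<^bsub>G n\<^esub> alt n i (d (Suc n) i y))"
      unfolding bd_Suc using that by (intro finprod_cong') auto
    also have "\<dots> = bd (Suc n) x \<otimes>\<^bsub>G n\<^esub> bd (Suc n) y"
      unfolding bd_Suc using that by (intro finprod_multf) auto
    finally show ?thesis .
  qed
qed

lemma bd_group_hom: "group_hom (G (Suc n)) (G n) (bd (Suc n))"
  by (simp add: group_hom_def group_hom_axioms_def bd_hom)

lemma bd_closed [simp]: "x \<in> carrier (G (Suc n)) \<Longrightarrow> bd (Suc n) x \<in> carrier (G n)"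
  using bd_hom by (auto simp: hom_def)

lemma bd_mult [simp]: "\<lbrakk>x \<in> carrier (G (Suc n)); y \<in> carrier (G (Suc n))\<rbrakk> \<Longrightarrow>
    bd (Suc n) (x \<otimes>\<^bsub>G (Suc n)\<^esub> y) = bd (Suc n) x \<otimes>\<^bsub>G n\<^esub> bd (Suc n) y"
  using bd_hom by (auto simp: hom_def)

lemma bd_inv [simp]: "x \<in> carrier (G (Suc n)) \<Longrightarrow>
    bd (Suc n) (inv\<^bsub>G (Suc n)\<^esub> x) = inv\<^bsub>G n\<^esub> bd (Suc n) x"
  by (rule group_hom.hom_inv[OF bd_group_hom])

lemma bd_alt [simp]: "x \<in> carrier (G (Suc n)) \<Longrightarrow>
    bd (Suc n) (alt (Suc n) j x) = alt n j (bd (Suc n) x)"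
  by (simp add: alt_cases)

text \<open>By \<open>d_i d_j = d_{j-1} d_i\<close> for \<open>i < j\<close>, the term at
  \<open>(i, j)\<close> is cancelled by the one at \<open>(j - 1, i)\<close>, which has the opposite
  sign. The map \<open>h\<close> is this matching between the pairs in \<open>P\<close> and those in
  \<open>Q\<close>.\<close>

lemma bd_bd:
  assumes x: "x \<in> carrier (G (Suc (Suc n)))"
  shows "bd (Suc n) (bd (Suc (Suc n)) x) = \<one>\<^bsub>G n\<^esub>"
proof -
  interpret comm_group "G n" by simp
  define F where "F = (\<lambda>(i, j). alt n i (alt n j (d (Suc n) i (d (Suc (Suc n)) j x))))"
  define P where "P = {(i, j). i < j \<and> j \<le> Suc (Suc n)}"
  define Q where "Q = {(i, j). j \<le> i \<and> i \<le> Suc n}"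
  define h :: "nat \<times> nat \<Rightarrow> nat \<times> nat" where "h = (\<lambda>(i, j). (j - 1, i))"
  have PQ: "{0..Suc n} \<times> {0..Suc (Suc n)} = P \<union> Q" "P \<inter> Q = {}"
    by (auto simp: P_def Q_def)
  have fin: "finite P" "finite Q"
    using PQ by (metis finite_Un finite_atLeastAtMost finite_SigmaI)+
  have F_closed: "F p \<in> carrier (G n)" if "p \<in> P \<union> Q" for p
    using that x unfolding PQ(1)[symmetric] by (auto simp: F_def)
  have hP: "h ` P = Q"
  proof
    show "Q \<subseteq> h ` P"
    proof
      fix p assume "p \<in> Q"
      then have "p = h (snd p, Suc (fst p))" "(snd p, Suc (fst p)) \<in> P"
        by (auto simp: h_def P_def Q_def)
      then show "p \<in> h ` P" by blast
    qed
  qed (auto simp: h_def P_def Q_def)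
  have inj: "inj_on h P" by (auto simp: inj_on_def h_def P_def)
  have Fh: "F p \<otimes>\<^bsub>G n\<^esub> F (h p) = \<one>\<^bsub>G n\<^esub>" if p: "p \<in> P" for p
  proof -
    obtain i j where ij: "p = (i, Suc j)" "i \<le> j" "j \<le> Suc n"
      using p by (cases p; cases "snd p") (auto simp: P_def)
    define w where "w = d (Suc n) j (d (Suc (Suc n)) i x)"
    have w: "w \<in> carrier (G n)" using ij x by (simp add: w_def)
    have "F p = alt n i (alt n (Suc j) w)" using ij x by (simp add: F_def d_d w_def)
    moreover have "F (h p) = alt n j (alt n i w)" using ij by (simp add: F_def h_def w_def)
    ultimately show ?thesis using w by (auto simp: alt_cases)
  qed
  have "bd (Suc n) (bd (Suc (Suc n)) x) =
      (\<Otimes>\<^bsub>G n\<^esub>i\<in>{0..Suc n}. \<Otimes>\<^bsub>G n\<^esub>j\<in>{0..Suc (Suc n)}. F (i, j))"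
    unfolding bd_Suc[of n]
  proof (rule finprod_cong')
    fix i assume i: "i \<in> {0..Suc n}"
    have "d (Suc n) i (bd (Suc (Suc n)) x) =
        (\<Otimes>\<^bsub>G n\<^esub>j\<in>{0..Suc (Suc n)}. d (Suc n) i (alt (Suc n) j (d (Suc (Suc n)) j x)))"
      unfolding bd_Suc using i x by (subst comm_group_hom_finprod[OF _ _ d_hom]) auto
    moreover have "alt n i \<in> hom (G n) (G n)" by (auto simp: hom_def)
    ultimately show "alt n i (d (Suc n) i (bd (Suc (Suc n)) x)) =
        (\<Otimes>\<^bsub>G n\<^esub>j\<in>{0..Suc (Suc n)}. F (i, j))"
      using i x by (simp, subst comm_group_hom_finprod[where h = "alt n i" and H = "G n"])
        (auto simp: F_def intro!: finprod_cong')
  next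
    show "(\<lambda>i. \<Otimes>\<^bsub>G n\<^esub>j\<in>{0..Suc (Suc n)}. F (i, j)) \<in> {0..Suc n} \<rightarrow> carrier (G n)"
      using x by (intro funcsetI finprod_closed) (auto simp: F_def)
  qed simp
  also have "\<dots> = finprod (G n) F ({0..Suc n} \<times> {0..Suc (Suc n)})"
    using x by (subst finprod_finprod) (auto simp: F_def)
  also have "\<dots> = finprod (G n) F P \<otimes>\<^bsub>G n\<^esub> finprod (G n) F Q"
    unfolding PQ(1) using fin PQ(2) F_closed by (simp add: finprod_Un_disjoint)
  also have "finprod (G n) F Q = (\<Otimes>\<^bsub>G n\<^esub>p\<in>P. F (h p))"
    unfolding hP[symmetric] using F_closed inj hP by (intro finprod_reindex) auto
  also have "finprod (G n) F P \<otimes>\<^bsub>G n\<^esub> \<dots> = (\<Otimes>\<^bsub>G n\<^esub>p\<in>P. F p \<otimes>\<^bsub>G n\<^esub> F (h p))"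
    using F_closed hP by (intro finprod_multf[symmetric] funcsetI) (metis UnI1 UnI2 imageI)+
  also have "\<dots> = \<one>\<^bsub>G n\<^esub>" using Fh by (rule finprod_one_eqI)
  finally show ?thesis .
qed

text \<open>When \<open>n = 0\<close> the product is empty, so the meaningless \<open>d 0\<close> never contributes.\<close>

lemma bd_degen:
  assumes y: "y \<in> carrier (G n)" and p: "p \<le> n"
    and low: "\<And>j. \<lbrakk>n = Suc m; j < p\<rbrakk> \<Longrightarrow> d n j y = \<one>\<^bsub>G m\<^esub>"
    and n: "n = 0 \<or> n = Suc m"
  shows "bd (Suc n) (s n p y) = (\<Otimes>\<^bsub>G n\<^esub>i\<in>{Suc p..n}. inv\<^bsub>G n\<^esub> alt n i (s (n - 1) p (d n i y)))"
proof -
  interpret comm_group "G n" by simp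
  define h where "h = (\<lambda>i. alt n i (d (Suc n) i (s n p y)))"
  have h_closed: "h i \<in> carrier (G n)" if "i \<le> Suc n" for i using that y p by (simp add: h_def)
  \<comment> \<open>For \<open>i < p\<close> the identity \<open>d_i s_p = s_{p-1} d_i\<close> and
    the vanishing of the low faces of \<open>y\<close> make the term trivial.\<close>
  have "finprod (G n) h {0..Suc n} = finprod (G n) h ({p, Suc p} \<union> {Suc (Suc p)..Suc n})"
  proof (rule finprod_mono_neutral_cong_right)
    fix i assume "i \<in> {0..Suc n} - ({p, Suc p} \<union> {Suc (Suc p)..Suc n})"
    then have "i < p" by auto
    then obtain q where q: "p = Suc q" "i \<le> q" by (cases p) auto
    with p n have nm: "n = Suc m" "q \<le> m" by auto
    then have "d (Suc n) i (s n p y) = s m q (d n i y)" using y q by (simp add: d_s_less)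
    then show "h i = \<one>\<^bsub>G n\<^esub>" using low[of i] \<open>i < p\<close> nm by (simp add: h_def)
  qed (use h_closed p in auto)
  also have "\<dots> = finprod (G n) h {p, Suc p} \<otimes>\<^bsub>G n\<^esub> finprod (G n) h {Suc (Suc p)..Suc n}"
    using h_closed p by (intro finprod_Un_disjoint) auto
  \<comment> \<open>The faces \<open>p\<close> and \<open>p + 1\<close> of \<open>s_p y\<close> are
    both \<open>y\<close> and enter with opposite signs.\<close>
  also have "finprod (G n) h {p, Suc p} = h p \<otimes>\<^bsub>G n\<^esub> h (Suc p)" using h_closed p by simp
  also have "\<dots> = \<one>\<^bsub>G n\<^esub>" using y p by (simp add: h_def d_s_same alt_Suc)
  also have "\<one>\<^bsub>G n\<^esub> \<otimes>\<^bsub>G n\<^esub> finprod (G n) h {Suc (Suc p)..Suc n} = finprod (G n) h (Suc ` {Suc p..n})"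
    using h_closed by (simp add: image_Suc_atLeastAtMost del: image_Suc_atLeastAtMost)
      (simp add: Pi_def)
  also have "\<dots> = (\<Otimes>\<^bsub>G n\<^esub>i\<in>{Suc p..n}. h (Suc i))" using h_closed by (intro finprod_reindex) auto
  also have "\<dots> = (\<Otimes>\<^bsub>G n\<^esub>i\<in>{Suc p..n}. inv\<^bsub>G n\<^esub> alt n i (s (n - 1) p (d n i y)))"
  proof (rule finprod_cong')
    \<comment> \<open>Here \<open>d_{i+1} s_p = s_p d_i\<close>; the shift of the index by one is
      what produces the inverse.\<close>
    fix i assume i: "i \<in> {Suc p..n}"
    with n have "n = Suc m" by auto
    with i p y show "h (Suc i) = inv\<^bsub>G n\<^esub> alt n i (s (n - 1) p (d n i y))"
      by (simp add: h_def d_s_greater alt_Suc)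
  next
    show "(\<lambda>i. inv\<^bsub>G n\<^esub> alt n i (s (n - 1) p (d n i y))) \<in> {Suc p..n} \<rightarrow> carrier (G n)"
      using n y by (auto)
  qed simp
  finally show ?thesis by (simp add: bd_Suc h_def)
qed

text \<open>A chain homotopy formula: \<open>bd s_p + s_p bd = (-1)^p s_p d_p\<close> on elements
  whose faces below \<open>p\<close> vanish. Of the terms of \<open>bd y\<close>, those above
  \<open>p\<close> form \<open>T\<close>; the boundary of \<open>s_p y\<close> is
  \<open>- s_p T\<close>, and completing \<open>T\<close> to the full boundary of \<open>y\<close>
  leaves the term at \<open>p\<close> over.\<close>

lemma bd_degen_Suc:
  assumes y: "y \<in> carrier (G (Suc n))" and p: "p \<le> n"
    and low: "\<And>j. j < p \<Longrightarrow> d (Suc n) j y = \<one>\<^bsub>G n\<^esub>"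
  shows "bd (Suc (Suc n)) (s (Suc n) p y) =
    inv\<^bsub>G (Suc n)\<^esub> s n p (bd (Suc n) y) \<otimes>\<^bsub>G (Suc n)\<^esub> alt (Suc n) p (s n p (d (Suc n) p y))"
proof -
  interpret G0: comm_group "G n" by simp
  interpret G1: comm_group "G (Suc n)" by simp
  define T where "T = (\<Otimes>\<^bsub>G n\<^esub>i\<in>{Suc p..Suc n}. alt n i (d (Suc n) i y))"
  have T: "T \<in> carrier (G n)" unfolding T_def using y by (intro G0.finprod_closed) auto
  have "bd (Suc n) y = (\<Otimes>\<^bsub>G n\<^esub>i\<in>insert p {Suc p..Suc n}. alt n i (d (Suc n) i y))"
    unfolding bd_Suc using low p y by (intro G0.finprod_mono_neutral_cong_right) auto
  also have "\<dots> = alt n p (d (Suc n) p y) \<otimes>\<^bsub>G n\<^esub> T"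
    unfolding T_def using y p by (intro G0.finprod_insert) auto
  finally have bd: "bd (Suc n) y = alt n p (d (Suc n) p y) \<otimes>\<^bsub>G n\<^esub> T" .
  have "bd (Suc (Suc n)) (s (Suc n) p y) =
      (\<Otimes>\<^bsub>G (Suc n)\<^esub>i\<in>{Suc p..Suc n}. inv\<^bsub>G (Suc n)\<^esub> s n p (alt n i (d (Suc n) i y)))"
    using y p low by (subst bd_degen[where m = n]) (auto intro!: G1.finprod_cong')
  also have "\<dots> = inv\<^bsub>G (Suc n)\<^esub> s n p T"
    unfolding T_def using y p
    by (subst G1.finprod_inv, force, subst comm_group_hom_finprod[OF _ _ s_hom]) auto
  finally show ?thesis using bd T y p
    by (simp add: G1.inv_mult G1.m_ac G1.inv_solve_left G1.inv_solve_right)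
qed

text \<open>Replacing a cycle \<open>x\<close> by \<open>x - s\<^sub>p d\<^sub>p x\<close> kills the face \<open>p\<close>; as the faces below \<open>p\<close> vanish, the
  correction is plus or minus the boundary of \<open>s\<^sub>p x\<close>.\<close>

lemma normalize_cycle:
  assumes x: "x \<in> carrier (G (Suc n))" "bd (Suc n) x = \<one>\<^bsub>G n\<^esub>" and "p \<le> Suc n"
  shows "\<exists>w\<in>carrier (G (Suc (Suc n))).
    \<forall>j<p. d (Suc n) j (x \<otimes>\<^bsub>G (Suc n)\<^esub> bd (Suc (Suc n)) w) = \<one>\<^bsub>G n\<^esub>"
  using assms(3)
proof (induction p)
  case 0
  show ?case using one_closed by blast
next
  case (Suc p)
  interpret G0: comm_group "G n" by simp
  interpret G1: comm_group "G (Suc n)" by simp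
  interpret G2: comm_group "G (Suc (Suc n))" by simp
  from Suc obtain w where w: "w \<in> carrier (G (Suc (Suc n)))"
    and low: "\<And>j. j < p \<Longrightarrow> d (Suc n) j (x \<otimes>\<^bsub>G (Suc n)\<^esub> bd (Suc (Suc n)) w) = \<one>\<^bsub>G n\<^esub>" by auto
  define x' where "x' = x \<otimes>\<^bsub>G (Suc n)\<^esub> bd (Suc (Suc n)) w"
  have x': "x' \<in> carrier (G (Suc n))" "bd (Suc n) x' = \<one>\<^bsub>G n\<^esub>"
    using x w by (auto simp: x'_def bd_bd)
  define v where "v = s n p (d (Suc n) p x')"
  have p: "p \<le> n" using Suc.prems by simp
  have v: "v \<in> carrier (G (Suc n))" using x' p by (simp add: v_def)
  \<comment> \<open>As \<open>x'\<close> is a cycle, only the second term of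
    \<open>bd_degen_Suc\<close> survives. Its sign is moved to the other side, so that
    \<open>v\<close> itself is a boundary.\<close>
  have "bd (Suc (Suc n)) (s (Suc n) p x') = alt (Suc n) p v"
    using x' low p by (subst bd_degen_Suc) (auto simp: x'_def v_def)
  then have bdv: "bd (Suc (Suc n)) (alt (Suc (Suc n)) p (s (Suc n) p x')) = v"
    using x' p v by simp
  define w' where "w' = w \<otimes>\<^bsub>G (Suc (Suc n))\<^esub> inv\<^bsub>G (Suc (Suc n))\<^esub> alt (Suc (Suc n)) p (s (Suc n) p x')"
  have w': "w' \<in> carrier (G (Suc (Suc n)))" using w x' p by (simp add: w'_def)
  have eq: "x \<otimes>\<^bsub>G (Suc n)\<^esub> bd (Suc (Suc n)) w' = x' \<otimes>\<^bsub>G (Suc n)\<^esub> inv\<^bsub>G (Suc n)\<^esub> v"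
    using w x x' p bdv v by (simp add: w'_def x'_def G1.m_assoc)
  have "d (Suc n) j (x' \<otimes>\<^bsub>G (Suc n)\<^esub> inv\<^bsub>G (Suc n)\<^esub> v) = \<one>\<^bsub>G n\<^esub>" if j: "j < Suc p" for j
  proof (cases "j = p")
    case True
    then show ?thesis using x' v p by (simp, simp add: v_def d_s_same)
  next
    case False
    then obtain q where q: "p = Suc q" "j \<le> q" using j by (cases p) auto
    obtain m where m: "n = Suc m" using p q by (cases n) auto
    have "d (Suc n) j v = s m q (d n j (d (Suc n) p x'))"
      using x' q m p by (simp add: v_def d_s_less)
    also have "d n j (d (Suc n) p x') = d n q (d (Suc n) j x')"
      using x' q m p by (simp add: d_d)
    also have "d (Suc n) j x' = \<one>\<^bsub>G n\<^esub>" using low[of j] q by (simp add: x'_def)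
    finally show ?thesis using x' v p q m low[of j] by (simp, simp add: x'_def)
  qed
  then show ?case using eq by (intro bexI[OF _ w']) simp
qed

lemma normalized_cycle_exists:
  assumes x: "x \<in> carrier (G (Suc n))" "bd (Suc n) x = \<one>\<^bsub>G n\<^esub>"
  shows "\<exists>w\<in>carrier (G (Suc (Suc n))).
    \<forall>j\<le>Suc n. d (Suc n) j (x \<otimes>\<^bsub>G (Suc n)\<^esub> bd (Suc (Suc n)) w) = \<one>\<^bsub>G n\<^esub>"
proof -
  interpret G0: comm_group "G n" by simp
  interpret G1: comm_group "G (Suc n)" by simp
  obtain w where w: "w \<in> carrier (G (Suc (Suc n)))"
    and low: "\<And>j. j < Suc n \<Longrightarrow> d (Suc n) j (x \<otimes>\<^bsub>G (Suc n)\<^esub> bd (Suc (Suc n)) w) = \<one>\<^bsub>G n\<^esub>"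
    using normalize_cycle[OF x, of "Suc n"] by auto
  define x' where "x' = x \<otimes>\<^bsub>G (Suc n)\<^esub> bd (Suc (Suc n)) w"
  have x': "x' \<in> carrier (G (Suc n))" "bd (Suc n) x' = \<one>\<^bsub>G n\<^esub>"
    using x w by (auto simp: x'_def bd_bd)
  have "bd (Suc n) x' = (\<Otimes>\<^bsub>G n\<^esub>i\<in>{Suc n}. alt n i (d (Suc n) i x'))"
    unfolding bd_Suc using low x'(1) 
    by (intro G0.finprod_mono_neutral_cong_right) (auto simp: x'_def)
  then have "alt n (Suc n) (d (Suc n) (Suc n) x') = \<one>\<^bsub>G n\<^esub>" using x' by simp
  then have "d (Suc n) (Suc n) x' = \<one>\<^bsub>G n\<^esub>" using x' by (simp add: alt_cases split: if_splits)
  with low w show ?thesis by (metis le_neq_implies_less le_imp_less_Suc x'_def)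
qed

text \<open>The cycles of the Moore complex. As in \<open>Zcomb\<close>, the condition is void in
  degree \<open>0\<close>.\<close>

definition normalized_cycles :: "nat \<Rightarrow> 'g set" where
  "normalized_cycles n = {x \<in> carrier (G n). n = 0 \<or> (\<forall>j\<le>n. d n j x = \<one>\<^bsub>G (n - 1)\<^esub>)}"

text \<open>The same replacement of \<open>z\<close> by \<open>z - s\<^sub>p d\<^sub>p z\<close> does not change the boundary \<open>x\<close> of \<open>z\<close>: up to
  boundaries and sign, \<open>s\<^sub>p d\<^sub>p z\<close> is \<open>s\<^sub>p x\<close>, which is a cycle because all faces of \<open>x\<close> vanish.\<close>

lemma normalize_filling:
  assumes y: "y \<in> carrier (G (Suc n))" and x: "bd (Suc n) y \<in> normalized_cycles n"
    and "p \<le> Suc n"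
  shows "\<exists>y'\<in>carrier (G (Suc n)). bd (Suc n) y' = bd (Suc n) y \<and>
    (\<forall>j<p. d (Suc n) j y' = \<one>\<^bsub>G n\<^esub>)"
  using assms(3)
proof (induction p)
  case 0
  then show ?case using y by auto
next
  case (Suc p)
  interpret G0: comm_group "G n" by simp
  interpret G1: comm_group "G (Suc n)" by simp
  interpret G2: comm_group "G (Suc (Suc n))" by simp
  from Suc obtain z where z: "z \<in> carrier (G (Suc n))" "bd (Suc n) z = bd (Suc n) y"
    and low: "\<And>j. j < p \<Longrightarrow> d (Suc n) j z = \<one>\<^bsub>G n\<^esub>" by auto
  have p: "p \<le> n" using Suc.prems by simp
  define x where "x = bd (Suc n) y"
  have xc: "x \<in> carrier (G n)" using y by (simp add: x_def)
  define v where "v = s n p (d (Suc n) p z)"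
  have v: "v \<in> carrier (G (Suc n))" using z p by (simp add: v_def)
  \<comment> \<open>All terms that \<open>bd_degen\<close> leaves contain a face of
    \<open>x\<close>, and these are trivial; for \<open>n = 0\<close> no term is left.\<close>
  have "bd (Suc n) (s n p x) =
      (\<Otimes>\<^bsub>G n\<^esub>i\<in>{Suc p..n}. inv\<^bsub>G n\<^esub> alt n i (s (n - 1) p (d n i x)))"
    using x p xc by (intro bd_degen[where m = "n - 1"]) (auto simp: normalized_cycles_def x_def)
  also have "\<dots> = \<one>\<^bsub>G n\<^esub>"
  proof (rule G0.finprod_one_eqI)
    fix i assume i: "i \<in> {Suc p..n}"
    then obtain m where m: "n = Suc m" by (cases n) auto
    then have "d n i x = \<one>\<^bsub>G m\<^esub>" using x i by (simp add: normalized_cycles_def x_def)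
    then show "inv\<^bsub>G n\<^esub> alt n i (s (n - 1) p (d n i x)) = \<one>\<^bsub>G n\<^esub>"
      using i m by simp
  qed
  finally have sx: "bd (Suc n) (s n p x) = \<one>\<^bsub>G n\<^esub>" .
  have "bd (Suc (Suc n)) (s (Suc n) p z) =
      inv\<^bsub>G (Suc n)\<^esub> s n p x \<otimes>\<^bsub>G (Suc n)\<^esub> alt (Suc n) p v"
    using z low p by (subst bd_degen_Suc) (auto simp: x_def v_def)
  \<comment> \<open>The term with \<open>s_p x\<close> disappears by \<open>sx\<close> and the left
    side by \<open>bd_bd\<close>. Hence \<open>v\<close> is a cycle and can be subtracted from
    \<open>z\<close> without changing the boundary.\<close>
  then have "bd (Suc n) (bd (Suc (Suc n)) (s (Suc n) p z)) = alt n p (bd (Suc n) v)"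
    using xc p v sx by simp
  then have "alt n p (bd (Suc n) v) = \<one>\<^bsub>G n\<^esub>" using z p by (simp add: bd_bd)
  then have bdv: "bd (Suc n) v = \<one>\<^bsub>G n\<^esub>" using v by (simp add: alt_cases split: if_splits)
  have "d (Suc n) j (z \<otimes>\<^bsub>G (Suc n)\<^esub> inv\<^bsub>G (Suc n)\<^esub> v) = \<one>\<^bsub>G n\<^esub>" if j: "j < Suc p" for j
  proof (cases "j = p")
    case True
    then show ?thesis using z v p by (simp, simp add: v_def d_s_same)
  next
    case False
    then obtain q where q: "p = Suc q" "j \<le> q" using j by (cases p) auto
    obtain m where m: "n = Suc m" using p q by (cases n) auto
    have "d (Suc n) j v = s m q (d n j (d (Suc n) p z))"
      using z q m p by (simp add: v_def d_s_less)
    also have "d n j (d (Suc n) p z) = d n q (d (Suc n) j z)"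
      using z q m p by (simp add: d_d)
    also have "d (Suc n) j z = \<one>\<^bsub>G n\<^esub>" using low[of j] q by simp
    finally show ?thesis using z v p q m low[of j] by simp
  qed
  then show ?case using z v bdv y by (intro bexI[of _ "z \<otimes>\<^bsub>G (Suc n)\<^esub> inv\<^bsub>G (Suc n)\<^esub> v"]) auto
qed

text \<open>Witnesses of the combinatorial relation have this shape, so their boundary is, up to
  sign, the difference of the two related elements.\<close>

lemma bd_top_two:
  assumes "z \<in> carrier (G (Suc n))" "\<And>j. j < n \<Longrightarrow> d (Suc n) j z = \<one>\<^bsub>G n\<^esub>"
  shows "bd (Suc n) z = alt n n (d (Suc n) n z \<otimes>\<^bsub>G n\<^esub> inv\<^bsub>G n\<^esub> d (Suc n) (Suc n) z)"
proof -
  interpret G0: comm_group "G n" by simp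
  have "bd (Suc n) z = (\<Otimes>\<^bsub>G n\<^esub>i\<in>{n, Suc n}. alt n i (d (Suc n) i z))"
    unfolding bd_Suc using assms by (intro G0.finprod_mono_neutral_cong_right) auto
  then show ?thesis using assms by (simp add: alt_Suc inv_alt)
qed

text \<open>The right-hand side is a congruence, so the one-step relation is an equivalence on
  normalized cycles. For the backward direction an arbitrary filling of the difference is given
  trivial faces up to \<open>n\<close>; \<open>normalize_filling\<close> applies because the
  difference of two normalized cycles is again one.\<close>

lemma normalized_homologous_iff:
  assumes x: "x \<in> normalized_cycles n" and y: "y \<in> normalized_cycles n"
  shows "(\<exists>z\<in>carrier (G (Suc n)). (\<forall>j<n. d (Suc n) j z = \<one>\<^bsub>G n\<^esub>) \<and>
      d (Suc n) n z = x \<and> d (Suc n) (Suc n) z = y) \<longleftrightarrow>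
    x \<otimes>\<^bsub>G n\<^esub> inv\<^bsub>G n\<^esub> y \<in> bd (Suc n) ` carrier (G (Suc n))" (is "?L \<longleftrightarrow> ?R")
proof
  interpret G0: comm_group "G n" by simp
  interpret G1: comm_group "G (Suc n)" by simp
  have xc: "x \<in> carrier (G n)" "y \<in> carrier (G n)" using x y by (auto simp: normalized_cycles_def)
  {
    assume ?L
    then obtain z where z: "z \<in> carrier (G (Suc n))" "\<And>j. j < n \<Longrightarrow> d (Suc n) j z = \<one>\<^bsub>G n\<^esub>"
      "d (Suc n) n z = x" "d (Suc n) (Suc n) z = y" by auto
    then have "bd (Suc n) (alt (Suc n) n z) = x \<otimes>\<^bsub>G n\<^esub> inv\<^bsub>G n\<^esub> y"
      using xc bd_top_two[of z n] by simp
    with z(1) show ?R by (metis alt_closed imageI)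
  }
  assume ?R
  then obtain w where w: "w \<in> carrier (G (Suc n))" "bd (Suc n) w = x \<otimes>\<^bsub>G n\<^esub> inv\<^bsub>G n\<^esub> y" by auto
  have "x \<otimes>\<^bsub>G n\<^esub> inv\<^bsub>G n\<^esub> y \<in> normalized_cycles n"
    using x y by (cases n) (auto simp: normalized_cycles_def)
  with normalize_filling[OF w(1), of "Suc n"] w(2)
  obtain w' where w': "w' \<in> carrier (G (Suc n))" "bd (Suc n) w' = x \<otimes>\<^bsub>G n\<^esub> inv\<^bsub>G n\<^esub> y"
    "\<And>j. j \<le> n \<Longrightarrow> d (Suc n) j w' = \<one>\<^bsub>G n\<^esub>" by (auto simp: less_Suc_eq_le)
  \<comment> \<open>With this sign the last face of \<open>u\<close> is \<open>y - x\<close> for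
    either parity of \<open>n\<close>.\<close>
  define u where "u = alt (Suc n) n w'"
  have u: "u \<in> carrier (G (Suc n))" "\<And>j. j \<le> n \<Longrightarrow> d (Suc n) j u = \<one>\<^bsub>G n\<^esub>"
    using w' by (auto simp: u_def)
  have dw: "d (Suc n) (Suc n) w' \<in> carrier (G n)" using w' by simp
  have "x \<otimes>\<^bsub>G n\<^esub> inv\<^bsub>G n\<^esub> y = inv\<^bsub>G n\<^esub> d (Suc n) (Suc n) u"
    using w' bd_top_two[of w' n] dw by (simp add: u_def inv_alt)
  then have "inv\<^bsub>G n\<^esub> (inv\<^bsub>G n\<^esub> d (Suc n) (Suc n) u) = inv\<^bsub>G n\<^esub> (x \<otimes>\<^bsub>G n\<^esub> inv\<^bsub>G n\<^esub> y)"
    by simp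
  then have du: "d (Suc n) (Suc n) u = y \<otimes>\<^bsub>G n\<^esub> inv\<^bsub>G n\<^esub> x"
    using u(1) xc by (simp add: G0.inv_mult_group)
  \<comment> \<open>Both top faces of \<open>s_n x\<close> are \<open>x\<close> and its lower faces
    are trivial, so adding it to \<open>u\<close> yields the top faces \<open>x\<close> and
    \<open>(y - x) + x = y\<close>.\<close>
  define z where "z = u \<otimes>\<^bsub>G (Suc n)\<^esub> s n n x"
  have sx: "d (Suc n) j (s n n x) = \<one>\<^bsub>G n\<^esub>" if j: "j < n" for j
  proof -
    from j obtain m where m: "n = Suc m" by (cases n) auto
    with j xc x show ?thesis by (simp add: d_s_less normalized_cycles_def)
  qed
  have "z \<in> carrier (G (Suc n))" using u xc by (simp add: z_def)
  moreover have "d (Suc n) j z = \<one>\<^bsub>G n\<^esub>" if "j < n" for j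
    using that u xc sx by (simp add: z_def)
  moreover have "d (Suc n) n z = x" using u xc by (simp add: z_def d_s_same)
  moreover have "d (Suc n) (Suc n) z = y" using u xc du by (simp add: z_def d_s_same G0.m_assoc)
  ultimately show ?L by auto
qed

end


section \<open>Reduced chains\<close>

text \<open>The body of \<open>chain_group\<close> for an arbitrary pointed set, so that chains
  become a functor of the set alone and also make sense on smash products and on the sets to which
  \<open>HA\<close> is extended.\<close>

definition reduced_chains :: "('a, 'b) monoid_scheme \<Rightarrow> 's pset \<Rightarrow> ('s \<Rightarrow> 'a) monoid" where
  "reduced_chains A S =
     \<lparr>carrier = {c. (\<forall>x. c x \<in> carrier A) \<and> finite {x. c x \<noteq> \<one>\<^bsub>A\<^esub>} \<and>
                    {x. c x \<noteq> \<one>\<^bsub>A\<^esub>} \<subseteq> carrier S - {point S}},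
      monoid.mult = (\<lambda>c d x. c x \<otimes>\<^bsub>A\<^esub> d x),
      one = (\<lambda>x. \<one>\<^bsub>A\<^esub>)\<rparr>"

lemma chain_group_eq_reduced_chains: "chain_group n X A = reduced_chains A (simp X n)"
  by (simp add: chain_group_def reduced_chains_def)

lemma reduced_chains_mult [simp]: "(c \<otimes>\<^bsub>reduced_chains A S\<^esub> d) x = c x \<otimes>\<^bsub>A\<^esub> d x"
  by (simp add: reduced_chains_def)

lemma reduced_chains_one [simp]: "\<one>\<^bsub>reduced_chains A S\<^esub> x = \<one>\<^bsub>A\<^esub>"
  by (simp add: reduced_chains_def)

lemma reduced_chainsI:
  assumes "\<And>x. c x \<in> carrier A" "finite F" "F \<subseteq> carrier S - {point S}" "\<And>x. x \<notin> F \<Longrightarrow> c x = \<one>\<^bsub>A\<^esub>"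
  shows "c \<in> carrier (reduced_chains A S)"
proof -
  have "{x. c x \<noteq> \<one>\<^bsub>A\<^esub>} \<subseteq> F" using assms(4) by auto
  with assms show ?thesis by (auto simp: reduced_chains_def intro: finite_subset)
qed

lemma reduced_chainsD:
  assumes "c \<in> carrier (reduced_chains A S)"
  shows "c x \<in> carrier A" "finite {x. c x \<noteq> \<one>\<^bsub>A\<^esub>}" "c x \<noteq> \<one>\<^bsub>A\<^esub> \<Longrightarrow> x \<in> carrier S"
    "c x \<noteq> \<one>\<^bsub>A\<^esub> \<Longrightarrow> x \<noteq> point S" "c (point S) = \<one>\<^bsub>A\<^esub>"
  using assms by (auto simp: reduced_chains_def)

context comm_group
begin

lemma reduced_chains_comm_group: "comm_group (reduced_chains G S)"
proof (rule comm_groupI)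
  fix c d assume c: "c \<in> carrier (reduced_chains G S)" and d: "d \<in> carrier (reduced_chains G S)"
  show "c \<otimes>\<^bsub>reduced_chains G S\<^esub> d \<in> carrier (reduced_chains G S)"
  proof (rule reduced_chainsI[where F = "{x. c x \<noteq> \<one>} \<union> {x. d x \<noteq> \<one>}"])
    show "{x. c x \<noteq> \<one>} \<union> {x. d x \<noteq> \<one>} \<subseteq> carrier S - {point S}"
      using reduced_chainsD(3,4)[OF c] reduced_chainsD(3,4)[OF d] by blast
  qed (use reduced_chainsD(1,2)[OF c] reduced_chainsD(1,2)[OF d] in auto)
  show "c \<otimes>\<^bsub>reduced_chains G S\<^esub> d = d \<otimes>\<^bsub>reduced_chains G S\<^esub> c"
    using reduced_chainsD(1)[OF c] reduced_chainsD(1)[OF d] by (intro ext) (simp add: m_comm)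
  fix e assume e: "e \<in> carrier (reduced_chains G S)"
  show "c \<otimes>\<^bsub>reduced_chains G S\<^esub> d \<otimes>\<^bsub>reduced_chains G S\<^esub> e = c \<otimes>\<^bsub>reduced_chains G S\<^esub> (d \<otimes>\<^bsub>reduced_chains G S\<^esub> e)"
    using reduced_chainsD(1)[OF c] reduced_chainsD(1)[OF d] reduced_chainsD(1)[OF e]
    by (intro ext) (simp add: m_assoc)
next
  show "\<one>\<^bsub>reduced_chains G S\<^esub> \<in> carrier (reduced_chains G S)" by (rule reduced_chainsI[where F = "{}"]) auto
next
  fix c assume c: "c \<in> carrier (reduced_chains G S)"
  show "\<one>\<^bsub>reduced_chains G S\<^esub> \<otimes>\<^bsub>reduced_chains G S\<^esub> c = c"
    using reduced_chainsD(1)[OF c] by (intro ext) simp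
  have "(\<lambda>x. inv (c x)) \<in> carrier (reduced_chains G S)"
    using reduced_chainsD(1-4)[OF c] by (intro reduced_chainsI[where F = "{x. c x \<noteq> \<one>}"]) auto
  moreover have "(\<lambda>x. inv (c x)) \<otimes>\<^bsub>reduced_chains G S\<^esub> c = \<one>\<^bsub>reduced_chains G S\<^esub>"
    using reduced_chainsD(1)[OF c] by (intro ext) simp
  ultimately show "\<exists>d\<in>carrier (reduced_chains G S). d \<otimes>\<^bsub>reduced_chains G S\<^esub> c = \<one>\<^bsub>reduced_chains G S\<^esub>" by blast
qed

text \<open>Evaluation transfers products and powers of chains to pointwise ones in
  \<open>A\<close>, which is the form used in \<open>chain_boundary\<close> and in
  \<open>EM\<close>.\<close>

lemma eval_hom: "(\<lambda>c. c x) \<in> hom (reduced_chains G S) G"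
  by (rule homI) (simp_all add: reduced_chainsD(1))

lemma reduced_chains_finprod:
  "f \<in> I \<rightarrow> carrier (reduced_chains G S) \<Longrightarrow> finprod (reduced_chains G S) f I x = (\<Otimes>i\<in>I. f i x)"
  using comm_group_hom_finprod[OF reduced_chains_comm_group comm_group_axioms eval_hom] .

lemma reduced_chains_int_pow:
  "c \<in> carrier (reduced_chains G S) \<Longrightarrow> (c [^]\<^bsub>reduced_chains G S\<^esub> (z :: int)) x = c x [^] z"
  using comm_group_hom_int_pow[OF reduced_chains_comm_group comm_group_axioms eval_hom] .

section \<open>Functoriality of reduced chains in the pointed set\<close>

lemma push_chain_superset:
  assumes c: "c \<in> carrier (reduced_chains G S)" and F: "finite F" "{x. c x \<noteq> \<one>} \<subseteq> F" and y: "y \<noteq> point T"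
  shows "push_chain G T \<phi> c y = (\<Otimes>x\<in>{x \<in> F. \<phi> x = y}. c x)"
proof -
  have "(\<Otimes>x\<in>{x. c x \<noteq> \<one> \<and> \<phi> x = y}. c x) = (\<Otimes>x\<in>{x \<in> F. \<phi> x = y}. c x)"
    using F reduced_chainsD(1)[OF c] by (intro finprod_mono_neutral_cong_left) auto
  with y show ?thesis by (simp add: push_chain_def)
qed

lemma push_chain_point [simp]: "push_chain G T \<phi> c (point T) = \<one>"
  by (simp add: push_chain_def)

lemma push_chain_support:
  "push_chain G T \<phi> c y \<noteq> \<one> \<Longrightarrow> y \<in> \<phi> ` {x. c x \<noteq> \<one>} - {point T}"
proof (rule ccontr)
  assume *: "push_chain G T \<phi> c y \<noteq> \<one>" "y \<notin> \<phi> ` {x. c x \<noteq> \<one>} - {point T}"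
  from *(1) have y: "y \<noteq> point T" by (metis push_chain_point)
  with *(2) have "{x. c x \<noteq> \<one> \<and> \<phi> x = y} = {}" by blast
  with y have "push_chain G T \<phi> c y = \<one>" unfolding push_chain_def by (simp only: finprod_empty if_False)
  with *(1) show False by contradiction
qed

lemma push_chain_closed:
  assumes c: "c \<in> carrier (reduced_chains G S)" and \<phi>: "\<phi> \<in> carrier S \<rightarrow> carrier T"
  shows "push_chain G T \<phi> c \<in> carrier (reduced_chains G T)"
proof (rule reduced_chainsI[where F = "\<phi> ` {x. c x \<noteq> \<one>} - {point T}"])
  show "push_chain G T \<phi> c y \<in> carrier G" for y
    unfolding push_chain_def using reduced_chainsD(1)[OF c] by auto
  show "\<phi> ` {x. c x \<noteq> \<one>} - {point T} \<subseteq> carrier T - {point T}"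
  proof
    fix y assume "y \<in> \<phi> ` {x. c x \<noteq> \<one>} - {point T}"
    then obtain x where "c x \<noteq> \<one>" "y = \<phi> x" "y \<noteq> point T" by blast
    with reduced_chainsD(3)[OF c this(1)] \<phi> show "y \<in> carrier T - {point T}" by blast
  qed
  show "push_chain G T \<phi> c y = \<one>" if "y \<notin> \<phi> ` {x. c x \<noteq> \<one>} - {point T}" for y
    using push_chain_support[of T \<phi> c y] that by (cases "push_chain G T \<phi> c y = \<one>") simp_all
qed (use reduced_chainsD(2)[OF c] in simp)

lemma push_chain_hom:
  assumes \<phi>: "\<phi> \<in> carrier S \<rightarrow> carrier T"
  shows "push_chain G T \<phi> \<in> hom (reduced_chains G S) (reduced_chains G T)"
proof (rule homI)
  fix c d assume c: "c \<in> carrier (reduced_chains G S)" and d: "d \<in> carrier (reduced_chains G S)"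
  \<comment> \<open>The supports of \<open>c\<close>, of \<open>d\<close> and of their product
    differ in general, so all three sums are taken over the union of the first two.\<close>
  let ?F = "{x. c x \<noteq> \<one>} \<union> {x. d x \<noteq> \<one>}"
  have cd: "c \<otimes>\<^bsub>reduced_chains G S\<^esub> d \<in> carrier (reduced_chains G S)"
    using c d by (rule comm_group.axioms(1)[OF reduced_chains_comm_group, THEN comm_monoid.axioms(1), THEN monoid.m_closed])
  show "push_chain G T \<phi> (c \<otimes>\<^bsub>reduced_chains G S\<^esub> d) =
      push_chain G T \<phi> c \<otimes>\<^bsub>reduced_chains G T\<^esub> push_chain G T \<phi> d"
  proof
    fix y
    show "push_chain G T \<phi> (c \<otimes>\<^bsub>reduced_chains G S\<^esub> d) y =
      (push_chain G T \<phi> c \<otimes>\<^bsub>reduced_chains G T\<^esub> push_chain G T \<phi> d) y"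
    proof (cases "y = point T")
      case False
      have "push_chain G T \<phi> (c \<otimes>\<^bsub>reduced_chains G S\<^esub> d) y =
          (\<Otimes>x\<in>{x \<in> ?F. \<phi> x = y}. c x \<otimes> d x)"
        using reduced_chainsD(2)[OF c] reduced_chainsD(2)[OF d] False
        by (subst push_chain_superset[OF cd, where F = ?F])
          (auto intro!: finprod_cong' reduced_chainsD(1)[OF c] reduced_chainsD(1)[OF d])
      also have "\<dots> = (\<Otimes>x\<in>{x \<in> ?F. \<phi> x = y}. c x) \<otimes> (\<Otimes>x\<in>{x \<in> ?F. \<phi> x = y}. d x)"
        using reduced_chainsD(1)[OF c] reduced_chainsD(1)[OF d] by (intro finprod_multf) auto
      also have "(\<Otimes>x\<in>{x \<in> ?F. \<phi> x = y}. c x) = push_chain G T \<phi> c y"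
        using reduced_chainsD(2)[OF c] reduced_chainsD(2)[OF d] False by (intro push_chain_superset[OF c, symmetric]) auto
      also have "(\<Otimes>x\<in>{x \<in> ?F. \<phi> x = y}. d x) = push_chain G T \<phi> d y"
        using reduced_chainsD(2)[OF c] reduced_chainsD(2)[OF d] False by (intro push_chain_superset[OF d, symmetric]) auto
      also have "push_chain G T \<phi> c y \<otimes> push_chain G T \<phi> d y =
          (push_chain G T \<phi> c \<otimes>\<^bsub>reduced_chains G T\<^esub> push_chain G T \<phi> d) y"
        by simp
      finally show ?thesis .
    qed simp
  qed
qed (use push_chain_closed \<phi> in blast)

text \<open>Agreement on the carrier is enough since it contains the support; the simplicial
  identities of \<open>X\<close> hold only there.\<close>

lemma push_chain_cong:
  assumes c: "c \<in> carrier (reduced_chains G S)" and "\<And>x. x \<in> carrier S \<Longrightarrow> \<phi> x = \<psi> x"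
  shows "push_chain G T \<phi> c = push_chain G T \<psi> c"
proof -
  have "{x. c x \<noteq> \<one> \<and> \<phi> x = y} = {x. c x \<noteq> \<one> \<and> \<psi> x = y}" for y
    using assms(2) reduced_chainsD(3)[OF c] by metis
  then show ?thesis by (intro ext) (simp add: push_chain_def)
qed

lemma push_chain_id:
  assumes c: "c \<in> carrier (reduced_chains G S)"
  shows "push_chain G S (\<lambda>x. x) c = c"
proof
  fix y
  have "{x. c x \<noteq> \<one> \<and> x = y} = (if c y = \<one> then {} else {y})" by auto
  then show "push_chain G S (\<lambda>x. x) c y = c y"
    using reduced_chainsD[OF c] by (auto simp: push_chain_def)
qed

text \<open>Elements sent to \<open>point T\<close> are lost in the first step; as
  \<open>\<psi>\<close> preserves the base point, the composite discards them too. Over any other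
  \<open>y\<close> the fibre of the composite in the support is the disjoint union of the fibres of
  \<open>\<phi>\<close> over \<open>J\<close>.\<close>

lemma push_chain_comp:
  assumes c: "c \<in> carrier (reduced_chains G S)" and \<phi>: "\<phi> \<in> carrier S \<rightarrow> carrier T"
    and \<psi>: "\<psi> (point T) = point U"
  shows "push_chain G U \<psi> (push_chain G T \<phi> c) = push_chain G U (\<lambda>x. \<psi> (\<phi> x)) c"
proof
  fix y
  show "push_chain G U \<psi> (push_chain G T \<phi> c) y = push_chain G U (\<lambda>x. \<psi> (\<phi> x)) c y"
  proof (cases "y = point U")
    case False
    define F where "F = {x. c x \<noteq> \<one>}"
    have F: "finite F" using reduced_chainsD(2)[OF c] by (simp add: F_def)
    define J where "J = {t \<in> \<phi> ` F. \<psi> t = y}"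
    have "push_chain G U \<psi> (push_chain G T \<phi> c) y = (\<Otimes>t\<in>J. push_chain G T \<phi> c t)"
      unfolding J_def
    proof (rule push_chain_superset[OF push_chain_closed[OF c \<phi>]])
      show "{t. push_chain G T \<phi> c t \<noteq> \<one>} \<subseteq> \<phi> ` F"
        using push_chain_support[of T \<phi> c] unfolding F_def by (metis (mono_tags, lifting) Diff_iff mem_Collect_eq subsetI)
    qed (use F False in auto)
    also have "\<dots> = (\<Otimes>t\<in>J. finprod G c {x \<in> F. \<phi> x = t})"
    proof (rule finprod_cong')
      fix t assume "t \<in> J"
      then have "t \<noteq> point T" using False \<psi> by (auto simp: J_def)
      then show "push_chain G T \<phi> c t = finprod G c {x \<in> F. \<phi> x = t}"
        unfolding push_chain_def F_def by simp
    qed (use reduced_chainsD(1)[OF c] in auto)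
    also have "\<dots> = finprod G c (\<Union>t\<in>J. {x \<in> F. \<phi> x = t})"
      using F reduced_chainsD(1)[OF c]
      by (intro finprod_UN_disjoint[symmetric]) (auto simp: J_def pairwise_def disjnt_def)
    also have "(\<Union>t\<in>J. {x \<in> F. \<phi> x = t}) = {x. c x \<noteq> \<one> \<and> \<psi> (\<phi> x) = y}"
      by (auto simp: J_def F_def)
    also have "finprod G c \<dots> = push_chain G U (\<lambda>x. \<psi> (\<phi> x)) c y"
      unfolding push_chain_def using False by simp
    finally show ?thesis .
  qed simp
qed

text \<open>The shape of a simplicial identity: two composites that may pass through different
  degrees, as in \<open>d s = s d\<close>.\<close>

lemma push_chain_comp_eq:
  assumes c: "c \<in> carrier (reduced_chains G S)" and "\<phi> \<in> carrier S \<rightarrow> carrier T" "\<phi>' \<in> carrier S \<rightarrow> carrier T'"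
    and "\<psi> (point T) = point U" "\<psi>' (point T') = point U"
    and "\<And>x. x \<in> carrier S \<Longrightarrow> \<psi> (\<phi> x) = \<psi>' (\<phi>' x)"
  shows "push_chain G U \<psi> (push_chain G T \<phi> c) = push_chain G U \<psi>' (push_chain G T' \<phi>' c)"
proof -
  have "push_chain G U (\<lambda>x. \<psi> (\<phi> x)) c = push_chain G U (\<lambda>x. \<psi>' (\<phi>' x)) c"
    using assms(6) by (rule push_chain_cong[OF c])
  then show ?thesis using assms(2-5) by (simp add: push_chain_comp[OF c])
qed

end

section \<open>The simplicial abelian group of reduced chains\<close>

locale simplicial_chains = A: comm_group A + pointed_simplicial_set X
  for A :: "('a, 'b) monoid_scheme" and X :: "'x psset"

definition chain_face :: "('a, 'b) monoid_scheme \<Rightarrow> 'x psset \<Rightarrow> nat \<Rightarrow> nat \<Rightarrow> ('x \<Rightarrow> 'a) \<Rightarrow> 'x \<Rightarrow> 'a"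
  where "chain_face A X n i = push_chain A (simp X (n - 1)) (face X n i)"

definition chain_degen :: "('a, 'b) monoid_scheme \<Rightarrow> 'x psset \<Rightarrow> nat \<Rightarrow> nat \<Rightarrow> ('x \<Rightarrow> 'a) \<Rightarrow> 'x \<Rightarrow> 'a"
  where "chain_degen A X n i = push_chain A (simp X (n + 1)) (degen X n i)"

lemma chain_face_Suc: "chain_face A X (Suc n) i = push_chain A (simp X n) (face X (Suc n) i)"
  by (simp add: chain_face_def)

text \<open>Functoriality of \<open>push_chain\<close> carries each identity of \<open>X\<close>
  over to chains. The case \<open>d s = id\<close> is treated separately because its right-hand side
  is not a composite.\<close>

sublocale simplicial_chains \<subseteq> simplicial_comm_group
  "\<lambda>n. chain_group n X A" "chain_face A X" "chain_degen A X"
proof (rule simplicial_comm_group.intro)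
  have face: "face X (Suc n) i \<in> carrier (simp X (Suc n)) \<rightarrow> carrier (simp X n)"
    "face X (Suc n) i (point (simp X (Suc n))) = point (simp X n)" if "i \<le> Suc n" for n i
    using face_pointed[OF that] by (auto simp: pointed_map_def)
  have degen: "degen X n i \<in> carrier (simp X n) \<rightarrow> carrier (simp X (Suc n))"
    "degen X n i (point (simp X n)) = point (simp X (Suc n))" if "i \<le> n" for n i
    using degen_pointed[OF that] by (auto simp: pointed_map_def)
  have face_closed: "face X (Suc n) i x \<in> carrier (simp X n)"
    if "i \<le> Suc n" "x \<in> carrier (simp X (Suc n))" for n i x
    using face(1)[OF that(1)] that(2) by blast
  have degen_closed: "degen X n i x \<in> carrier (simp X (Suc n))"
    if "i \<le> n" "x \<in> carrier (simp X n)" for n i x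
    using degen(1)[OF that(1)] that(2) by blast
  fix n i j
  show "comm_group (chain_group n X A)"
    by (simp add: chain_group_eq_reduced_chains A.reduced_chains_comm_group)
  show "chain_face A X (Suc n) i \<in> hom (chain_group (Suc n) X A) (chain_group n X A)"
    if "i \<le> Suc n"
    unfolding chain_group_eq_reduced_chains using face(1)[OF that] by (simp add: A.push_chain_hom chain_face_def)
  show "chain_degen A X n i \<in> hom (chain_group n X A) (chain_group (Suc n) X A)"
    if "i \<le> n"
    unfolding chain_group_eq_reduced_chains using degen(1)[OF that] by (simp add: A.push_chain_hom chain_degen_def)
  note [simp] = chain_group_eq_reduced_chains chain_face_def chain_degen_def
  show "chain_face A X (Suc n) i
       (chain_face A X (Suc (Suc n)) (Suc j) x) =
      chain_face A X (Suc n) j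
       (chain_face A X (Suc (Suc n)) i x)"
    if "i \<le> j" "j \<le> Suc n" "x \<in> carrier (chain_group (Suc (Suc n)) X A)" for x
    using that face_face[of i "Suc j" n]
    by (simp, intro A.push_chain_comp_eq) (auto simp: face degen face_closed degen_closed)
  show "chain_face A X (Suc (Suc n)) i
       (chain_degen A X (Suc n) (Suc j) x) =
      chain_degen A X n j (chain_face A X (Suc n) i x)"
    if "i \<le> j" "j \<le> n" "x \<in> carrier (chain_group (Suc n) X A)" for x
    using that face_degen_less[of i "Suc j" "Suc n"]
    by (simp, intro A.push_chain_comp_eq) (auto simp: face degen face_closed degen_closed)
  show "chain_face A X (Suc (Suc n)) (Suc i)
       (chain_degen A X (Suc n) j x) =
      chain_degen A X n j (chain_face A X (Suc n) i x)"
    if "j < i" "i \<le> Suc n" "x \<in> carrier (chain_group (Suc n) X A)" for x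
    using that face_degen_greater[of j "Suc i" "Suc n"]
    by (simp, intro A.push_chain_comp_eq) (auto simp: face degen face_closed degen_closed)
  show "chain_face A X (Suc n) i (chain_degen A X n j x) = x"
    if "i = j \<or> i = Suc j" "j \<le> n" "x \<in> carrier (chain_group n X A)" for x
  proof -
    have x: "x \<in> carrier (reduced_chains A (simp X n))" using that by simp
    have "chain_face A X (Suc n) i (chain_degen A X n j x) =
        push_chain A (simp X n) (\<lambda>x. face X (Suc n) i (degen X n j x)) x"
      using that x unfolding chain_face_Suc chain_degen_def Suc_eq_plus1[symmetric]
      by (intro A.push_chain_comp) (auto simp: face degen face_closed degen_closed)
    also have "\<dots> = push_chain A (simp X n) (\<lambda>x. x) x"
      using that face_degen_same[of i j n] by (intro A.push_chain_cong[OF x]) auto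
    finally show ?thesis using x by (simp add: A.push_chain_id)
  qed
qed

text \<open>One side multiplies values in \<open>A\<close>, the other multiplies chains and then
  evaluates; evaluation being a homomorphism, they agree.\<close>

lemma (in simplicial_chains) chain_boundary_eq_bd:
  assumes "c \<in> carrier (chain_group (Suc n) X A)"
  shows "chain_boundary (Suc n) X A c = bd (Suc n) c"
proof
  fix y
  have cl: "chain_face A X (Suc n) i c \<in> carrier (reduced_chains A (simp X n))"
    if "i \<le> Suc n" for i
    using d_closed[OF that assms] by (simp add: chain_group_eq_reduced_chains)
  have "bd (Suc n) c y = (\<Otimes>\<^bsub>A\<^esub>i\<in>{0..Suc n}. alt n i (chain_face A X (Suc n) i c) y)"
    using cl alt_closed[of _ n] unfolding bd_Suc unfolding chain_group_eq_reduced_chains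
    by (intro A.reduced_chains_finprod) auto
  also have "\<dots> = chain_boundary (Suc n) X A c y"
    unfolding chain_boundary_def diff_Suc_1 chain_face_Suc[symmetric]
  proof (rule A.finprod_cong')
    fix i assume "i \<in> {0..Suc n}"
    then show "alt n i (chain_face A X (Suc n) i c) y =
        chain_face A X (Suc n) i c y [^]\<^bsub>A\<^esub> ((- 1 :: int) ^ i)"
      unfolding alt_def unfolding chain_group_eq_reduced_chains by (intro A.reduced_chains_int_pow cl) auto
  qed (auto intro!: A.int_pow_closed reduced_chainsD(1)[OF cl])
  finally show "chain_boundary (Suc n) X A c y = bd (Suc n) c y" by simp
qed


section \<open>The extension of an Eilenberg-MacLane Gamma-set to pointed sets\<close>

lemma fin_subsD:
  assumes "F \<in> fin_subs S"
  shows "finite F" "point S \<in> F" "F \<subseteq> carrier S"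
  using assms by (auto simp: fin_subs_def)

text \<open>Gives access to the choice in \<open>enum\<close>: a suitable bijection exists, obtained
  by numbering the elements other than the base point from \<open>1\<close> and putting the base
  point at \<open>0\<close>.\<close>

lemma enum_bij:
  assumes F: "F \<in> fin_subs S"
  shows "bij_betw (enum (sub S F)) {0..rank (sub S F)} F" "enum (sub S F) 0 = point S"
proof -
  note F' = fin_subsD[OF F]
  have r: "rank (sub S F) = card (F - {point S})" using F' by (simp add: rank_def sub_def)
  obtain h where h: "bij_betw h {1..card (F - {point S})} (F - {point S})"
    using ex_bij_betw_nat_finite_1[of "F - {point S}"] F'(1) by auto
  define e where "e = (\<lambda>i. if i = 0 then point S else h i)"
  have "bij_betw e {1..rank (sub S F)} (F - {point S})"
    using h unfolding r by (rule bij_betw_cong[THEN iffD1, rotated]) (simp add: e_def)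
  then have "bij_betw e ({1..rank (sub S F)} \<union> {0}) ((F - {point S}) \<union> {e 0})"
    by (rule bij_betw_combine) (auto simp: e_def bij_betw_def)
  moreover have "{1..rank (sub S F)} \<union> {0} = {0..rank (sub S F)}" by auto
  moreover have "(F - {point S}) \<union> {e 0} = F" using F'(2) by (auto simp: e_def)
  ultimately have "bij_betw e {0..rank (sub S F)} (carrier (sub S F)) \<and> e 0 = point (sub S F)"
    by (simp add: e_def sub_def)
  then have "bij_betw (enum (sub S F)) {0..rank (sub S F)} (carrier (sub S F)) \<and>
      enum (sub S F) 0 = point (sub S F)"
    unfolding enum_def
    by (rule someI[where P = "\<lambda>e. bij_betw e {0..rank (sub S F)} (carrier (sub S F)) \<and> e 0 = point (sub S F)"])
  then show "bij_betw (enum (sub S F)) {0..rank (sub S F)} F" "enum (sub S F) 0 = point S"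
    by (simp_all add: sub_def)
qed

lemma index_enum:
  assumes "F \<in> fin_subs S" "i \<le> rank (sub S F)"
  shows "index (sub S F) (enum (sub S F) i) = i"
  using assms enum_bij(1)[OF assms(1)] by (simp add: index_def bij_betw_inv_into_left)

lemma enum_index:
  assumes "F \<in> fin_subs S" "s \<in> F"
  shows "enum (sub S F) (index (sub S F) s) = s"
  using assms enum_bij(1)[OF assms(1)] by (simp add: index_def bij_betw_inv_into_right)

lemma enum_bij_nonpoint:
  assumes F: "F \<in> fin_subs S"
  shows "bij_betw (enum (sub S F)) {1..rank (sub S F)} (F - {point S})"
proof -
  have "bij_betw (enum (sub S F)) ({0..rank (sub S F)} - {0}) (F - {enum (sub S F) 0})"
    using enum_bij(1)[OF F] by (intro bij_betw_DiffI) (auto simp: bij_betw_def)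
  moreover have "{0..rank (sub S F)} - {0} = {1..rank (sub S F)}" by auto
  ultimately show ?thesis using enum_bij(2)[OF F] by simp
qed

lemma enum_mem:
  assumes "F \<in> fin_subs S" "i \<in> {1..rank (sub S F)}"
  shows "enum (sub S F) i \<in> F - {point S}"
  using bij_betw_imp_surj_on[OF enum_bij_nonpoint[OF assms(1)]] assms(2) by blast

lemma index_mem:
  assumes F: "F \<in> fin_subs S" and s: "s \<in> F" "s \<noteq> point S"
  shows "index (sub S F) s \<in> {1..rank (sub S F)}"
proof -
  obtain i where "i \<in> {1..rank (sub S F)}" "s = enum (sub S F) i"
    using bij_betw_imp_surj_on[OF enum_bij_nonpoint[OF F]] s by blast
  then show ?thesis using index_enum[OF F] by simp
qed

text \<open>The coefficient function of a single pair, that is, \<open>coefficient\<close> before a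
  representative is chosen.\<close>

definition rep_chain :: "('a, 'b) monoid_scheme \<Rightarrow> 's pset \<Rightarrow> 's set \<times> (nat \<Rightarrow> 'a) \<Rightarrow> 's \<Rightarrow> 'a" where
  "rep_chain A S = (\<lambda>(F, m) s. if s \<in> F - {point S} then m (index (sub S F) s) else \<one>\<^bsub>A\<^esub>)"

lemma ext_elts_EM:
  "(F, m) \<in> ext_elts (EM A) S \<longleftrightarrow> F \<in> fin_subs S \<and> m \<in> {1..rank (sub S F)} \<rightarrow>\<^sub>E carrier A"
  by (simp add: ext_elts_def fin_obj_def EM_def)

context comm_group
begin

lemma rep_chain_closed:
  assumes "r \<in> ext_elts (EM G) S"
  shows "rep_chain G S r \<in> carrier (reduced_chains G S)"
proof -
  obtain F m where r: "r = (F, m)" by (cases r)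
  have F: "F \<in> fin_subs S" and m: "m \<in> {1..rank (sub S F)} \<rightarrow>\<^sub>E carrier G"
    using assms by (simp_all add: r ext_elts_EM)
  show ?thesis
  proof (rule reduced_chainsI[where F = "F - {point S}"])
    show "rep_chain G S r s \<in> carrier G" for s
      using index_mem[OF F] m by (auto simp: rep_chain_def r simp del: atLeastAtMost_iff)
  qed (use fin_subsD[OF F] in \<open>auto simp: rep_chain_def r\<close>)
qed

lemma rep_chain_inj:
  assumes "(F, m) \<in> ext_elts (EM G) S" "(F, m') \<in> ext_elts (EM G) S"
    and eq: "rep_chain G S (F, m) = rep_chain G S (F, m')"
  shows "m = m'"
proof (rule PiE_ext)
  have F: "F \<in> fin_subs S" using assms(1) by (simp add: ext_elts_EM)
  fix i assume i: "i \<in> {1..rank (sub S F)}"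
  from enum_mem[OF F i] show "m i = m' i"
    using fun_cong[OF eq, of "enum (sub S F) i"] index_enum[OF F, of i] i by (simp add: rep_chain_def)
qed (use assms in \<open>auto simp: ext_elts_EM\<close>)

lemma rep_chain_surj:
  assumes S: "pointed_set S" and c: "c \<in> carrier (reduced_chains G S)"
  obtains r where "r \<in> ext_elts (EM G) S" "rep_chain G S r = c"
proof
  \<comment> \<open>No support contains the base point, but every set in \<open>fin_subs\<close>
    must.\<close>
  define F where "F = insert (point S) {x. c x \<noteq> \<one>}"
  define m where "m = (\<lambda>i\<in>{1..rank (sub S F)}. c (enum (sub S F) i))"
  have F: "F \<in> fin_subs S"
    using reduced_chainsD(2,3)[OF c] S by (auto simp: F_def fin_subs_def pointed_set_def)
  show "(F, m) \<in> ext_elts (EM G) S"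
    using F reduced_chainsD(1)[OF c] by (auto simp: ext_elts_EM m_def)
  show "rep_chain G S (F, m) = c"
  proof
    fix s show "rep_chain G S (F, m) s = c s"
    proof (cases "s \<in> F - {point S}")
      case True
      then show ?thesis using index_mem[OF F] enum_index[OF F] by (simp add: rep_chain_def m_def)
    next
      case False
      then have "c s = \<one>" using reduced_chainsD(5)[OF c] by (auto simp: F_def)
      with False show ?thesis unfolding rep_chain_def by (simp only: if_False prod.case)
    qed
  qed
qed

text \<open>On finite pointed sets the arrows of \<open>HA\<close> push chains forward, whatever the
  enumerations are. The target \<open>H\<close> may be larger than the image of \<open>F\<close>:
  this covers both the transition maps of the colimit, where \<open>\<phi>\<close> is the identity,
  and the maps used in \<open>ext_arr\<close>.\<close>

lemma fin_arr_rep: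
  assumes r: "(F, m) \<in> ext_elts (EM G) S" and H: "H \<in> fin_subs T"
    and \<phi>: "\<phi> ` F \<subseteq> H" "\<phi> (point S) = point T"
  shows "(H, fin_arr (EM G) (sub S F) (sub T H) \<phi> m) \<in> ext_elts (EM G) T" (is ?mem)
    and "rep_chain G T (H, fin_arr (EM G) (sub S F) (sub T H) \<phi> m) =
      push_chain G T \<phi> (rep_chain G S (F, m))" (is ?eq)
proof -
  have F: "F \<in> fin_subs S" and m: "m \<in> {1..rank (sub S F)} \<rightarrow>\<^sub>E carrier G"
    using r by (simp_all add: ext_elts_EM)
  note c = rep_chain_closed[OF r]
  let ?e = "enum (sub S F)" and ?i = "index (sub T H)"
  have arr: "fin_arr (EM G) (sub S F) (sub T H) \<phi> m =
      (\<lambda>j\<in>{1..rank (sub T H)}. \<Otimes>i\<in>{i \<in> {1..rank (sub S F)}. ?i (\<phi> (?e i)) = j}. m i)"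
    by (simp add: fin_arr_def EM_def)
  show ?mem
    unfolding arr using H m by (auto simp: ext_elts_EM Pi_iff PiE_iff intro!: finprod_closed)
  show ?eq
  proof
    fix t
    show "rep_chain G T (H, fin_arr (EM G) (sub S F) (sub T H) \<phi> m) t =
      push_chain G T \<phi> (rep_chain G S (F, m)) t"
    proof (cases "t \<in> H - {point T}")
      case True
      define I where "I = {i \<in> {1..rank (sub S F)}. \<phi> (?e i) = t}"
      note e_mem = enum_mem[OF F]
      \<comment> \<open>The numbering of \<open>H\<close> is injective, so equality of indices is
        equality of elements.\<close>
      have "{i \<in> {1..rank (sub S F)}. ?i (\<phi> (?e i)) = ?i t} = I"
        unfolding I_def
      proof (intro Collect_cong conj_cong refl)
        fix i assume i: "i \<in> {1..rank (sub S F)}"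
        have "\<phi> (?e i) \<in> H" using e_mem[OF i] \<phi>(1) by blast
        then show "?i (\<phi> (?e i)) = ?i t \<longleftrightarrow> \<phi> (?e i) = t"
          using enum_index[OF H] True by (metis Diff_iff)
      qed
      then have "rep_chain G T (H, fin_arr (EM G) (sub S F) (sub T H) \<phi> m) t = finprod G m I"
        using True index_mem[OF H] by (simp add: rep_chain_def arr)
      also have "\<dots> = (\<Otimes>i\<in>I. rep_chain G S (F, m) (?e i))"
      proof (rule finprod_cong')
        fix i assume "i \<in> I"
        then have "i \<in> {1..rank (sub S F)}" by (auto simp: I_def)
        with e_mem[OF this] index_enum[OF F, of i] show "m i = rep_chain G S (F, m) (?e i)"
          by (simp add: rep_chain_def)
      qed (use reduced_chainsD(1)[OF c] in auto)
      also have "\<dots> = finprod G (rep_chain G S (F, m)) (?e ` I)"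
      proof (rule finprod_reindex[symmetric])
        show "inj_on ?e I"
          by (rule inj_on_subset[OF bij_betw_imp_inj_on[OF enum_bij_nonpoint[OF F]]]) (auto simp: I_def)
      qed (use reduced_chainsD(1)[OF c] in simp)
      also have "?e ` I = {s \<in> F - {point S}. \<phi> s = t}"
      proof -
        have "?e ` I = {s \<in> ?e ` {1..rank (sub S F)}. \<phi> s = t}" unfolding I_def by blast
        then show ?thesis by (simp only: bij_betw_imp_surj_on[OF enum_bij_nonpoint[OF F]])
      qed
      also have "finprod G (rep_chain G S (F, m)) \<dots> = push_chain G T \<phi> (rep_chain G S (F, m)) t"
        using fin_subsD(1)[OF F] True
        by (intro push_chain_superset[OF c, symmetric]) (auto simp: rep_chain_def)
      finally show ?thesis .
    next
      case False
      have "{s. rep_chain G S (F, m) s \<noteq> \<one>} \<subseteq> F" by (auto simp: rep_chain_def)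
      with \<phi>(1) False have "t \<notin> \<phi> ` {s. rep_chain G S (F, m) s \<noteq> \<one>} - {point T}" by blast
      with push_chain_support[of T \<phi> "rep_chain G S (F, m)" t]
      have "push_chain G T \<phi> (rep_chain G S (F, m)) t = \<one>" by argo
      with False show ?thesis unfolding rep_chain_def by (simp only: if_False prod.case)
    qed
  qed
qed

text \<open>Transition maps do not change the chain, and over a fixed finite set the chain
  determines the tuple. Hence two pairs with equal chains become equal already over the union of
  their finite sets. Transitivity of the relation is then immediate.\<close>

lemma ext_rel_EM_iff:
  "(r, r') \<in> ext_rel (EM G) S \<longleftrightarrow>
    r \<in> ext_elts (EM G) S \<and> r' \<in> ext_elts (EM G) S \<and> rep_chain G S r = rep_chain G S r'"
proof (cases "r \<in> ext_elts (EM G) S \<and> r' \<in> ext_elts (EM G) S")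
  case True
  obtain F m F' m' where rr: "r = (F, m)" "r' = (F', m')" by (cases r; cases r')
  have r: "(F, m) \<in> ext_elts (EM G) S" "(F', m') \<in> ext_elts (EM G) S" using True rr by auto
  have push: "(H, fin_arr (EM G) (sub S K) (sub S H) id k) \<in> ext_elts (EM G) S"
    "rep_chain G S (H, fin_arr (EM G) (sub S K) (sub S H) id k) = rep_chain G S (K, k)"
    if "(K, k) \<in> ext_elts (EM G) S" "H \<in> fin_subs S" "K \<subseteq> H" for K k H
    using fin_arr_rep[of K k S H S id] that push_chain_id[OF rep_chain_closed[OF that(1)]]
    by (simp_all add: id_def)
  have F: "F \<in> fin_subs S" "F' \<in> fin_subs S" using r by (simp_all add: ext_elts_EM)
  then have U: "F \<union> F' \<in> fin_subs S" by (auto simp: fin_subs_def)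
  have "(\<exists>H\<in>fin_subs S. F \<subseteq> H \<and> F' \<subseteq> H \<and>
        fin_arr (EM G) (sub S F) (sub S H) id m = fin_arr (EM G) (sub S F') (sub S H) id m') \<longleftrightarrow>
      rep_chain G S (F, m) = rep_chain G S (F', m')" (is "?L \<longleftrightarrow> ?R")
  proof
    assume ?L
    then show ?R using push(2)[OF r(1)] push(2)[OF r(2)] by metis
  next
    assume ?R
    then have "fin_arr (EM G) (sub S F) (sub S (F \<union> F')) id m =
        fin_arr (EM G) (sub S F') (sub S (F \<union> F')) id m'"
      using push[OF r(1) U] push[OF r(2) U] by (intro rep_chain_inj) auto
    then show ?L using U by blast
  qed
  with r show ?thesis by (simp add: ext_rel_def rr)
qed (auto simp: ext_rel_def)

lemma ext_rel_EM_equiv: "equiv (ext_elts (EM G) S) (ext_rel (EM G) S)"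
  by (rule equivI) (auto simp: refl_on_def sym_def trans_def ext_rel_EM_iff)

text \<open>All representatives of a class have the same chain, so the choice in
  \<open>coefficient\<close> is harmless.\<close>

lemma coefficient_class:
  assumes "r \<in> ext_elts (EM G) S"
  shows "coefficient G S (ext_rel (EM G) S `` {r}) = rep_chain G S r"
proof -
  define r' where "r' = (SOME r'. r' \<in> ext_rel (EM G) S `` {r})"
  have "r \<in> ext_rel (EM G) S `` {r}" using assms by (simp add: ext_rel_EM_iff)
  then have "r' \<in> ext_rel (EM G) S `` {r}" unfolding r'_def by (rule someI)
  then have "rep_chain G S r = rep_chain G S r'" by (simp add: ext_rel_EM_iff)
  moreover have "coefficient G S (ext_rel (EM G) S `` {r}) = rep_chain G S r'"
    unfolding coefficient_def[abs_def] r'_def[symmetric] rep_chain_def by (simp split: prod.split)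
  ultimately show ?thesis by simp
qed

section \<open>The natural bijection between the extension of \<open>HA\<close> and reduced
  chains\<close>

lemma ext_obj_EM_cases:
  assumes "u \<in> carrier (ext_obj (EM G) S)"
  obtains r where "r \<in> ext_elts (EM G) S" "u = ext_rel (EM G) S `` {r}"
  using assms by (auto simp: ext_obj_def elim: quotientE)

lemma ext_obj_EM_classI:
  "r \<in> ext_elts (EM G) S \<Longrightarrow> ext_rel (EM G) S `` {r} \<in> carrier (ext_obj (EM G) S)"
  by (auto simp: ext_obj_def intro: quotientI)

lemma coefficient_bij:
  assumes "pointed_set S"
  shows "bij_betw (coefficient G S) (carrier (ext_obj (EM G) S)) (carrier (reduced_chains G S))"
proof (rule bij_betwI')
  fix u v assume "u \<in> carrier (ext_obj (EM G) S)" "v \<in> carrier (ext_obj (EM G) S)"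
  then obtain r r' where r: "r \<in> ext_elts (EM G) S" "u = ext_rel (EM G) S `` {r}"
    and r': "r' \<in> ext_elts (EM G) S" "v = ext_rel (EM G) S `` {r'}"
    by (auto elim!: ext_obj_EM_cases)
  have "u = v \<longleftrightarrow> (r, r') \<in> ext_rel (EM G) S"
    using eq_equiv_class_iff[OF ext_rel_EM_equiv r(1) r'(1)] r r' by simp
  then show "coefficient G S u = coefficient G S v \<longleftrightarrow> u = v"
    using r r' by (simp add: coefficient_class ext_rel_EM_iff)
next
  fix u assume "u \<in> carrier (ext_obj (EM G) S)"
  then show "coefficient G S u \<in> carrier (reduced_chains G S)"
    by (elim ext_obj_EM_cases) (simp add: coefficient_class rep_chain_closed)
next
  fix c assume "c \<in> carrier (reduced_chains G S)"
  then obtain r where "r \<in> ext_elts (EM G) S" "rep_chain G S r = c"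
    using rep_chain_surj assms by metis
  then show "\<exists>u\<in>carrier (ext_obj (EM G) S). c = coefficient G S u"
    by (intro bexI[of _ "ext_rel (EM G) S `` {r}"]) (simp_all add: coefficient_class ext_obj_EM_classI)
qed

lemma coefficient_point:
  assumes "pointed_set S"
  shows "point (ext_obj (EM G) S) \<in> carrier (ext_obj (EM G) S)"
    and "coefficient G S (point (ext_obj (EM G) S)) = \<one>\<^bsub>reduced_chains G S\<^esub>"
proof -
  define r where "r = ({point S}, point (fin_obj (EM G) (sub S {point S})))"
  have r: "r \<in> ext_elts (EM G) S"
    unfolding r_def ext_elts_EM using assms
    by (auto simp: fin_subs_def pointed_set_def fin_obj_def EM_def)
  have pt: "point (ext_obj (EM G) S) = ext_rel (EM G) S `` {r}" by (simp add: ext_obj_def r_def)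
  show "point (ext_obj (EM G) S) \<in> carrier (ext_obj (EM G) S)"
    unfolding pt using r by (rule ext_obj_EM_classI)
  show "coefficient G S (point (ext_obj (EM G) S)) = \<one>\<^bsub>reduced_chains G S\<^esub>"
    unfolding pt coefficient_class[OF r] by (auto simp: r_def rep_chain_def reduced_chains_def)
qed

text \<open>\<open>ext_arr\<close> maps all representatives of \<open>u\<close> at once. By
  \<open>fin_arr_rep\<close>, with the image of \<open>F\<close> as \<open>H\<close>, the resulting
  pairs have one common chain, so they generate a single class.\<close>

lemma coefficient_arr:
  assumes \<phi>: "pointed_map S T \<phi>" and u: "u \<in> carrier (ext_obj (EM G) S)"
  shows "ext_arr (EM G) S T \<phi> u \<in> carrier (ext_obj (EM G) T)"
    and "coefficient G T (ext_arr (EM G) S T \<phi> u) = push_chain G T \<phi> (coefficient G S u)"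
proof -
  define g where "g = (\<lambda>(F, m). (\<phi> ` F, fin_arr (EM G) (sub S F) (sub T (\<phi> ` F)) \<phi> m))"
  have g: "g r \<in> ext_elts (EM G) T" "rep_chain G T (g r) = push_chain G T \<phi> (rep_chain G S r)"
    if "r \<in> ext_elts (EM G) S" for r
  proof -
    obtain F m where r: "r = (F, m)" by (cases r)
    have "F \<in> fin_subs S" using that by (simp add: r ext_elts_EM)
    then have "\<phi> ` F \<in> fin_subs T" using \<phi>
      by (auto simp: fin_subs_def pointed_map_def image_subset_iff Pi_iff intro: rev_image_eqI)
    then show "g r \<in> ext_elts (EM G) T" "rep_chain G T (g r) = push_chain G T \<phi> (rep_chain G S r)"
      using fin_arr_rep[of F m S "\<phi> ` F" T \<phi>] that \<phi> by (simp_all add: r g_def pointed_map_def)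
  qed
  obtain r where r: "r \<in> ext_elts (EM G) S" "u = ext_rel (EM G) S `` {r}"
    using u by (rule ext_obj_EM_cases)
  have "ext_arr (EM G) S T \<phi> u = ext_rel (EM G) T `` (g ` u)"
    by (simp add: ext_arr_def g_def)
  also have "\<dots> = ext_rel (EM G) T `` {g r}"
  proof -
    have "r \<in> u" using r by (simp add: ext_rel_EM_iff)
    moreover have "rep_chain G T (g r') = rep_chain G T (g r)" if "r' \<in> u" for r'
      using that r g(2) by (simp add: ext_rel_EM_iff)
    moreover have "g r' \<in> ext_elts (EM G) T" if "r' \<in> u" for r'
      using that r g(1) by (simp add: ext_rel_EM_iff)
    moreover have "(g r', p) \<in> ext_rel (EM G) T \<longleftrightarrow> (g r, p) \<in> ext_rel (EM G) T" if "r' \<in> u" for r' p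
      using calculation that unfolding ext_rel_EM_iff by metis
    ultimately show ?thesis by blast
  qed
  finally have arr: "ext_arr (EM G) S T \<phi> u = ext_rel (EM G) T `` {g r}" .
  show "ext_arr (EM G) S T \<phi> u \<in> carrier (ext_obj (EM G) T)"
    unfolding arr using g(1)[OF r(1)] by (rule ext_obj_EM_classI)
  show "coefficient G T (ext_arr (EM G) S T \<phi> u) = push_chain G T \<phi> (coefficient G S u)"
    unfolding arr using r g[OF r(1)] by (simp add: coefficient_class)
qed

end


section \<open>Isomorphisms of Gamma-sets\<close>

lemma EM_gamma_set:
  assumes "comm_monoid A"
  shows "gamma_set (EM A)"
proof
  interpret comm_monoid A by fact
  have arr: "arr (EM A) k l f m = (\<lambda>j\<in>{1..l}. \<Otimes>\<^bsub>A\<^esub>i\<in>{i \<in> {1..k}. f i = j}. m i)" for k l f m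
    by (simp add: EM_def)
  have carrier: "carrier (obj (EM A) k) = {1..k} \<rightarrow>\<^sub>E carrier A" for k
    by (simp add: EM_def)
  have point: "point (obj (EM A) k) = (\<lambda>j\<in>{1..k}. \<one>\<^bsub>A\<^esub>)" for k
    by (simp add: EM_def)
  have closed: "(\<Otimes>\<^bsub>A\<^esub>i\<in>{i \<in> {1..k}. P i}. m i) \<in> carrier A"
    if "m \<in> {1..k} \<rightarrow>\<^sub>E carrier A" for k P m
    using that by (intro finprod_closed funcsetI) (auto simp: PiE_iff)
  show "pointed_set (obj (EM A) k)" for k
    by (auto simp: pointed_set_def carrier point)
  show "carrier (obj (EM A) 0) = {point (obj (EM A) 0)}"
    by (simp add: carrier point restrict_def)
  show "pointed_map (obj (EM A) k) (obj (EM A) l) (arr (EM A) k l f)" for k l f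
  proof -
    have "arr (EM A) k l f (\<lambda>j\<in>{1..k}. \<one>\<^bsub>A\<^esub>) = (\<lambda>j\<in>{1..l}. \<one>\<^bsub>A\<^esub>)"
      unfolding arr by (intro restrict_ext finprod_one_eqI) simp
    moreover have "arr (EM A) k l f m \<in> {1..l} \<rightarrow>\<^sub>E carrier A" if "m \<in> {1..k} \<rightarrow>\<^sub>E carrier A" for m
      unfolding arr using closed[OF that] by (auto simp only: restrict_PiE_iff)
    ultimately show ?thesis unfolding pointed_map_def carrier point by blast
  qed
  show "arr (EM A) k l f m = arr (EM A) k l g m" if "\<forall>i\<in>{0..k}. f i = g i" for k l f g m
  proof -
    have "{i \<in> {1..k}. f i = j} = {i \<in> {1..k}. g i = j}" for j using that by auto
    then show ?thesis by (simp only: arr)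
  qed
  show "arr (EM A) k k id m = m" if "m \<in> carrier (obj (EM A) k)" for k m
  proof
    fix j
    have m: "m \<in> {1..k} \<rightarrow>\<^sub>E carrier A" using that by (simp only: carrier)
    show "arr (EM A) k k id m j = m j"
    proof (cases "j \<in> {1..k}")
      case True
      then have "{i \<in> {1..k}. id i = j} = {j}" by auto
      moreover have "m j \<in> carrier A" using PiE_mem[OF m True] .
      ultimately show ?thesis using True by (simp add: arr)
    next
      case False
      then show ?thesis using PiE_arb[OF m False] by (simp add: arr restrict_def del: atLeastAtMost_iff)
    qed
  qed
  show "arr (EM A) k p (g \<circ> f) m = arr (EM A) l p g (arr (EM A) k l f m)"
    if f: "pointed_map (fin_pset k) (fin_pset l) f" and g: "pointed_map (fin_pset l) (fin_pset p) g"
      and m: "m \<in> carrier (obj (EM A) k)" for k l p f g m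
    unfolding arr
  proof (rule restrict_ext)
    fix j assume j: "j \<in> {1..p}"
    have m': "m i \<in> carrier A" if "i \<in> {1..k}" for i
      using m that unfolding carrier by (rule PiE_mem)
    let ?J = "{t \<in> {1..l}. g t = j}"
    \<comment> \<open>As \<open>g\<close> preserves the base point and \<open>j\<close> is not
      \<open>0\<close>, no \<open>i\<close> in this fibre is sent to \<open>0\<close> by
      \<open>f\<close>; summing over the values in \<open>{1..l}\<close> therefore loses
      nothing.\<close>
    have U: "{i \<in> {1..k}. (g \<circ> f) i = j} = (\<Union>t\<in>?J. {i \<in> {1..k}. f i = t})"
    proof -
      have "f i \<in> {1..l}" if i: "i \<in> {1..k}" "g (f i) = j" for i
      proof -
        have "f i \<in> {0..l}" using f i(1) by (auto simp: pointed_map_def fin_pset_def)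
        moreover have "f i \<noteq> 0"
        proof
          assume "f i = 0"
          with g i(2) have "j = 0" by (simp add: pointed_map_def fin_pset_def)
          with j show False by simp
        qed
        ultimately show ?thesis by simp
      qed
      then show ?thesis by auto
    qed
    have "(\<Otimes>\<^bsub>A\<^esub>i\<in>{i \<in> {1..k}. (g \<circ> f) i = j}. m i) = (\<Otimes>\<^bsub>A\<^esub>t\<in>?J. \<Otimes>\<^bsub>A\<^esub>i\<in>{i \<in> {1..k}. f i = t}. m i)"
      unfolding U using m' by (intro finprod_UN_disjoint) (auto simp: pairwise_def disjnt_def)
    also have "\<dots> = (\<Otimes>\<^bsub>A\<^esub>t\<in>?J. (\<lambda>j\<in>{1..l}. \<Otimes>\<^bsub>A\<^esub>i\<in>{i \<in> {1..k}. f i = j}. m i) t)"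
    proof (rule finprod_cong')
      show "(\<lambda>t. (\<lambda>j\<in>{1..l}. \<Otimes>\<^bsub>A\<^esub>i\<in>{i \<in> {1..k}. f i = j}. m i) t) \<in> ?J \<rightarrow> carrier A"
        using closed[OF m[unfolded carrier]] by (intro funcsetI) (simp del: atLeastAtMost_iff)
    qed simp_all
    finally show "(\<Otimes>\<^bsub>A\<^esub>i\<in>{i \<in> {1..k}. (g \<circ> f) i = j}. m i) =
        (\<Otimes>\<^bsub>A\<^esub>t\<in>?J. (\<lambda>j\<in>{1..l}. \<Otimes>\<^bsub>A\<^esub>i\<in>{i \<in> {1..k}. f i = j}. m i) t)" .
  qed
qed

lemma fin_pset_map_cong:
  "\<lbrakk>pointed_map (fin_pset k) (fin_pset l) f; \<forall>i\<in>{0..k}. f i = g i\<rbrakk> \<Longrightarrow>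
    pointed_map (fin_pset k) (fin_pset l) g"
  by (auto simp: pointed_map_def fin_pset_def Pi_iff)

text \<open>The functor laws of the source are inherited from the target along the bijections.\<close>

lemma gamma_isoI:
  assumes N: "gamma_set N"
    and pt: "\<And>k. pointed_set (obj M k)"
    and \<eta>: "\<And>k. pointed_map (obj M k) (obj N k) (\<eta> k)"
    and bij: "\<And>k. bij_betw (\<eta> k) (carrier (obj M k)) (carrier (obj N k))"
    and arr: "\<And>k l f. pointed_map (fin_pset k) (fin_pset l) f \<Longrightarrow>
      pointed_map (obj M k) (obj M l) (arr M k l f)"
    and nat: "\<And>k l f m. \<lbrakk>pointed_map (fin_pset k) (fin_pset l) f; m \<in> carrier (obj M k)\<rbrakk> \<Longrightarrow>
      \<eta> l (arr M k l f m) = arr N k l f (\<eta> k m)"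
  shows "gamma_iso M N \<eta>"
proof -
  interpret N: gamma_set N by fact
  have \<eta>_closed: "\<eta> k m \<in> carrier (obj N k)" if "m \<in> carrier (obj M k)" for k m
    using \<eta>[of k] that by (auto simp: pointed_map_def)
  have arr_closed: "arr M k l f m \<in> carrier (obj M l)"
    if "pointed_map (fin_pset k) (fin_pset l) f" "m \<in> carrier (obj M k)" for k l f m
    using arr[OF that(1)] that(2) by (auto simp: pointed_map_def)
  have inj: "m = m'" if "\<eta> k m = \<eta> k m'" "m \<in> carrier (obj M k)" "m' \<in> carrier (obj M k)" for k m m'
    using bij[of k] that by (auto simp: bij_betw_def inj_on_def)
  have "gamma_set M"
  proof
    show "pointed_set (obj M k)" for k by fact
    show "carrier (obj M 0) = {point (obj M 0)}"
    proof -
      have "m = point (obj M 0)" if m: "m \<in> carrier (obj M 0)" for m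
      proof (rule inj[OF _ m])
        show p: "point (obj M 0) \<in> carrier (obj M 0)" using pt[of 0] by (simp add: pointed_set_def)
        show "\<eta> 0 m = \<eta> 0 (point (obj M 0))"
          using \<eta>_closed[OF m] \<eta>_closed[OF p] by (simp add: N.obj_zero)
      qed
      with pt[of 0] show ?thesis unfolding pointed_set_def by blast
    qed
    fix k l f assume f: "pointed_map (fin_pset k) (fin_pset l) f"
    show "pointed_map (obj M k) (obj M l) (arr M k l f)" using f by (rule arr)
    fix m assume m: "m \<in> carrier (obj M k)"
    show "arr M k l f m = arr M k l g m" if fg: "\<forall>i\<in>{0..k}. f i = g i" for g
    proof (rule inj)
      have g: "pointed_map (fin_pset k) (fin_pset l) g" using f fg by (rule fin_pset_map_cong)
      show "\<eta> l (arr M k l f m) = \<eta> l (arr M k l g m)"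
        using nat[OF f m] nat[OF g m] N.arr_cong[OF f fg \<eta>_closed[OF m]] by simp
      show "arr M k l f m \<in> carrier (obj M l)" using f m by (rule arr_closed)
      show "arr M k l g m \<in> carrier (obj M l)"
        using fin_pset_map_cong[OF f fg] m by (rule arr_closed)
    qed
    show "arr M k p (g \<circ> f) m = arr M l p g (arr M k l f m)"
      if g: "pointed_map (fin_pset l) (fin_pset p) g" for p g
    proof (rule inj)
      have gf: "pointed_map (fin_pset k) (fin_pset p) (g \<circ> f)"
        using f g by (auto simp: pointed_map_def)
      show "\<eta> p (arr M k p (g \<circ> f) m) = \<eta> p (arr M l p g (arr M k l f m))"
        using nat[OF gf m] nat[OF f m] nat[OF g arr_closed[OF f m]] N.arr_comp[OF f g \<eta>_closed[OF m]]
        by simp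
      show "arr M k p (g \<circ> f) m \<in> carrier (obj M p)" using gf m by (rule arr_closed)
      show "arr M l p g (arr M k l f m) \<in> carrier (obj M p)"
        using g arr_closed[OF f m] by (rule arr_closed)
    qed
  next
    fix k m assume m: "m \<in> carrier (obj M k)"
    have id: "pointed_map (fin_pset k) (fin_pset k) id" by (simp add: pointed_map_def)
    show "arr M k k id m = m"
      by (rule inj[OF _ arr_closed[OF id m] m]) (simp add: nat[OF id m] N.arr_id[OF \<eta>_closed[OF m]])
  qed
  with assms show ?thesis unfolding gamma_iso_def by blast
qed


section \<open>Chains on a smash product with a finite pointed set\<close>

lemma smash_carrier_fin:
  "(x, j) \<in> carrier (smash S (fin_pset k)) - {point (smash S (fin_pset k))} \<longleftrightarrow>
    x \<in> carrier S - {point S} \<and> j \<in> {1..k}"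
  by (auto simp: smash_def fin_pset_def)

lemma smash_pointed: "pointed_set (smash S T)"
  by (simp add: smash_def pointed_set_def)

lemma smash_map_pointed:
  assumes "pointed_map S S' \<phi>" "pointed_map T T' \<psi>"
  shows "pointed_map (smash S T) (smash S' T') (smash_map S' T' \<phi> \<psi>)"
  using assms by (auto simp: pointed_map_def smash_def smash_map_def Pi_iff)

definition slice :: "'j \<Rightarrow> ('x \<times> 'j \<Rightarrow> 'a) \<Rightarrow> 'x \<Rightarrow> 'a" where
  "slice j c = (\<lambda>x. c (x, j))"

context comm_group
begin

lemma slice_closed:
  assumes c: "c \<in> carrier (reduced_chains G (smash S (fin_pset k)))" and j: "j \<in> {1..k}"
  shows "slice j c \<in> carrier (reduced_chains G S)"
proof (rule reduced_chainsI[where F = "fst ` {p. c p \<noteq> \<one>} - {point S}"])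
  show "slice j c x \<in> carrier G" for x using reduced_chainsD(1)[OF c, of "(x, j)"] by (simp add: slice_def)
  show "finite (fst ` {p. c p \<noteq> \<one>} - {point S})" using reduced_chainsD(2)[OF c] by simp
  show "fst ` {p. c p \<noteq> \<one>} - {point S} \<subseteq> carrier S - {point S}"
  proof
    fix x assume "x \<in> fst ` {p. c p \<noteq> \<one>} - {point S}"
    then obtain i where i: "c (x, i) \<noteq> \<one>" "x \<noteq> point S" by auto
    show "x \<in> carrier S - {point S}"
      using reduced_chainsD(3)[OF c i(1)] reduced_chainsD(4)[OF c i(1)] i(2)
        smash_carrier_fin[of x i S k] by blast
  qed
  show "slice j c x = \<one>" if x: "x \<notin> fst ` {p. c p \<noteq> \<one>} - {point S}" for x
  proof (rule ccontr)
    assume "slice j c x \<noteq> \<one>"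
    then have cx: "c (x, j) \<noteq> \<one>" by (simp add: slice_def)
    then have "x \<noteq> point S"
      using reduced_chainsD(3)[OF c cx] reduced_chainsD(4)[OF c cx] smash_carrier_fin[of x j S k] by blast
    with x cx show False by force
  qed
qed

lemma smash_chain_index:
  assumes c: "c \<in> carrier (reduced_chains G (smash S (fin_pset k)))" and "c (x, j) \<noteq> \<one>"
  shows "j \<in> {1..k}" "x \<in> carrier S - {point S}"
  using reduced_chainsD(3)[OF assms] reduced_chainsD(4)[OF assms] smash_carrier_fin[of x j S k] by blast+

text \<open>Away from the base point, the smash product consists of the pairs \<open>(x, j)\<close>
  with \<open>x\<close> not the base point and \<open>j\<close> in \<open>{1..k}\<close>. A chain is
  thus determined by these slices, and any \<open>k\<close> chains on \<open>S\<close> glue to a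
  finitely supported one.\<close>

lemma slices_bij:
  "bij_betw (\<lambda>c. \<lambda>j\<in>{1..k}. slice j c) (carrier (reduced_chains G (smash S (fin_pset k))))
    ({1..k} \<rightarrow>\<^sub>E carrier (reduced_chains G S))"
proof (rule bij_betwI')
  fix c c' assume c: "c \<in> carrier (reduced_chains G (smash S (fin_pset k)))"
    "c' \<in> carrier (reduced_chains G (smash S (fin_pset k)))"
  have "c = c'" if eq: "(\<lambda>j\<in>{1..k}. slice j c) = (\<lambda>j\<in>{1..k}. slice j c')"
  proof
    fix p show "c p = c' p"
    proof (cases p)
      case (Pair x j)
      show ?thesis
      proof (cases "j \<in> {1..k}")
        case True
        then have "slice j c = slice j c'" using fun_cong[OF eq, of j] by simp
        then show ?thesis unfolding slice_def Pair by (rule fun_cong)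
      next
        case False
        then show ?thesis using smash_chain_index(1)[OF c(1), of x j] smash_chain_index(1)[OF c(2), of x j]
          unfolding Pair by argo
      qed
    qed
  qed
  then show "(\<lambda>j\<in>{1..k}. slice j c) = (\<lambda>j\<in>{1..k}. slice j c') \<longleftrightarrow> c = c'" by blast
next
  fix c assume "c \<in> carrier (reduced_chains G (smash S (fin_pset k)))"
  then show "(\<lambda>j\<in>{1..k}. slice j c) \<in> {1..k} \<rightarrow>\<^sub>E carrier (reduced_chains G S)"
    using slice_closed by (simp only: restrict_PiE_iff) blast
next
  fix m assume "m \<in> {1..k} \<rightarrow>\<^sub>E carrier (reduced_chains G S)"
  then have m: "m j \<in> carrier (reduced_chains G S)" if "j \<in> {1..k}" for j using that by (rule PiE_mem)
  define c where "c = (\<lambda>(x, j). if j \<in> {1..k} then m j x else \<one>)"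
  have "c \<in> carrier (reduced_chains G (smash S (fin_pset k)))"
  proof (rule reduced_chainsI[where F = "\<Union>j\<in>{1..k}. (\<lambda>x. (x, j)) ` {x. m j x \<noteq> \<one>}"])
    show "c p \<in> carrier G" for p
      using reduced_chainsD(1)[OF m] by (simp add: c_def split: prod.split)
    show "finite (\<Union>j\<in>{1..k}. (\<lambda>x. (x, j)) ` {x. m j x \<noteq> \<one>})"
      using reduced_chainsD(2)[OF m] by blast
    show "(\<Union>j\<in>{1..k}. (\<lambda>x. (x, j)) ` {x. m j x \<noteq> \<one>}) \<subseteq>
        carrier (smash S (fin_pset k)) - {point (smash S (fin_pset k))}"
    proof
      fix p assume "p \<in> (\<Union>j\<in>{1..k}. (\<lambda>x. (x, j)) ` {x. m j x \<noteq> \<one>})"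
      then obtain x j where p: "p = (x, j)" and j: "j \<in> {1..k}" and x: "m j x \<noteq> \<one>" by blast
      show "p \<in> carrier (smash S (fin_pset k)) - {point (smash S (fin_pset k))}"
        unfolding p smash_carrier_fin
        using reduced_chainsD(3)[OF m[OF j] x] reduced_chainsD(4)[OF m[OF j] x] j by blast
    qed
    show "c p = \<one>" if "p \<notin> (\<Union>j\<in>{1..k}. (\<lambda>x. (x, j)) ` {x. m j x \<noteq> \<one>})" for p
      using that by (cases p) (auto simp: c_def)
  qed
  moreover have "m = (\<lambda>j\<in>{1..k}. slice j c)"
    using \<open>m \<in> {1..k} \<rightarrow>\<^sub>E carrier (reduced_chains G S)\<close>
    by (intro PiE_ext[of m "{1..k}" "\<lambda>_. carrier (reduced_chains G S)"])
      (auto simp: slice_def c_def m PiE_iff)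
  ultimately show "\<exists>c\<in>carrier (reduced_chains G (smash S (fin_pset k))).
      m = (\<lambda>j\<in>{1..k}. slice j c)" by blast
qed

text \<open>Such a map leaves the second coordinate alone: its fibre over \<open>(y, j)\<close> is a
  copy of the fibre of \<open>\<phi>\<close> over \<open>y\<close>, so it acts on each slice
  separately. Faces are of this kind.\<close>

lemma slice_push_left:
  assumes c: "c \<in> carrier (reduced_chains G (smash S (fin_pset k)))" and \<phi>: "pointed_map S T \<phi>"
    and j: "j \<in> {1..k}"
  shows "slice j (push_chain G (smash T (fin_pset k)) (smash_map T (fin_pset k) \<phi> id) c) =
    push_chain G T \<phi> (slice j c)"
proof
  let ?\<Phi> = "smash_map T (fin_pset k) \<phi> id"
  have \<Phi>: "pointed_map (smash S (fin_pset k)) (smash T (fin_pset k)) ?\<Phi>"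
    using \<phi> by (rule smash_map_pointed) (simp add: pointed_map_def)
  have pc: "push_chain G (smash T (fin_pset k)) ?\<Phi> c \<in> carrier (reduced_chains G (smash T (fin_pset k)))"
    using \<Phi> by (intro push_chain_closed[OF c]) (simp add: pointed_map_def)
  fix y
  show "slice j (push_chain G (smash T (fin_pset k)) ?\<Phi> c) y = push_chain G T \<phi> (slice j c) y"
  proof (cases "y = point T")
    case True
    then show ?thesis using reduced_chainsD(5)[OF slice_closed[OF pc j]] by simp
  next
    case False
    have set: "{p. c p \<noteq> \<one> \<and> ?\<Phi> p = (y, j)} = (\<lambda>x. (x, j)) ` {x. slice j c x \<noteq> \<one> \<and> \<phi> x = y}"
      using False j by (auto simp: smash_map_def slice_def fin_pset_def split: if_splits)
    have "slice j (push_chain G (smash T (fin_pset k)) ?\<Phi> c) y =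
        finprod G c {p. c p \<noteq> \<one> \<and> ?\<Phi> p = (y, j)}"
      using False by (simp add: slice_def push_chain_def smash_def)
    also have "\<dots> = (\<Otimes>x\<in>{x. slice j c x \<noteq> \<one> \<and> \<phi> x = y}. c (x, j))"
      unfolding set using reduced_chainsD(1)[OF c] by (intro finprod_reindex inj_onI funcsetI) simp_all
    finally show ?thesis using False by (simp add: push_chain_def slice_def)
  qed
qed

text \<open>The fibre over \<open>(x, j)\<close> is \<open>x\<close> paired with the fibre of
  \<open>f\<close> over \<open>j\<close>. This is where the summation formula for the arrows of
  \<open>HA\<close> reappears, now for chains.\<close>

lemma slice_push_right:
  assumes S: "pointed_set S" and c: "c \<in> carrier (reduced_chains G (smash S (fin_pset k)))"
    and f: "pointed_map (fin_pset k) (fin_pset l) f" and j: "j \<in> {1..l}"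
  shows "slice j (push_chain G (smash S (fin_pset l)) (smash_map S (fin_pset l) id f) c) =
    (\<lambda>x. \<Otimes>i\<in>{i \<in> {1..k}. f i = j}. slice i c x)"
proof
  let ?\<Phi> = "smash_map S (fin_pset l) id f"
  have \<Phi>: "pointed_map (smash S (fin_pset k)) (smash S (fin_pset l)) ?\<Phi>"
    using f by (intro smash_map_pointed) (simp add: pointed_map_def)
  have pc: "push_chain G (smash S (fin_pset l)) ?\<Phi> c \<in> carrier (reduced_chains G (smash S (fin_pset l)))"
    using \<Phi> by (intro push_chain_closed[OF c]) (simp add: pointed_map_def)
  fix x
  show "slice j (push_chain G (smash S (fin_pset l)) ?\<Phi> c) x = (\<Otimes>i\<in>{i \<in> {1..k}. f i = j}. slice i c x)"
  proof (cases "x = point S")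
    case True
    have "(\<Otimes>i\<in>{i \<in> {1..k}. f i = j}. slice i c x) = \<one>"
      using True reduced_chainsD(5)[OF slice_closed[OF c]] by (intro finprod_one_eqI) simp
    then show ?thesis using True reduced_chainsD(5)[OF slice_closed[OF pc j]] by simp
  next
    case False
    have set: "{p. c p \<noteq> \<one> \<and> ?\<Phi> p = (x, j)} = Pair x ` {i. c (x, i) \<noteq> \<one> \<and> f i = j}"
      using False j by (auto simp: smash_map_def fin_pset_def split: if_splits)
    have "slice j (push_chain G (smash S (fin_pset l)) ?\<Phi> c) x =
        finprod G c {p. c p \<noteq> \<one> \<and> ?\<Phi> p = (x, j)}"
      using False by (simp add: slice_def push_chain_def smash_def)
    also have "\<dots> = (\<Otimes>i\<in>{i. c (x, i) \<noteq> \<one> \<and> f i = j}. c (x, i))"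
      unfolding set using reduced_chainsD(1)[OF c] by (intro finprod_reindex inj_onI funcsetI) simp_all
    also have "\<dots> = (\<Otimes>i\<in>{i \<in> {1..k}. f i = j}. slice i c x)"
      unfolding slice_def using smash_chain_index(1)[OF c, of x] reduced_chainsD(1)[OF c]
      by (intro finprod_mono_neutral_cong_left) auto
    finally show ?thesis .
  qed
qed

end


section \<open>The combinatorial homotopy of the smash products\<close>

lemma (in group) rcos_eq_iff:
  assumes B: "subgroup B G" and "a \<in> carrier G" "b \<in> carrier G"
  shows "B #> a = B #> b \<longleftrightarrow> a \<otimes> inv b \<in> B"
proof
  assume "B #> a = B #> b"
  then have "a \<in> B #> b" using rcos_self[OF assms(2) B] by simp
  then show "a \<otimes> inv b \<in> B"
    using subgroup.rcos_module_imp[OF B is_group assms(3)] by blast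
next
  assume "a \<otimes> inv b \<in> B"
  then have "a \<in> B #> b" using subgroup.rcos_module_rev[OF B is_group] assms by blast
  then show "B #> a = B #> b" using repr_independence[OF _ assms(3) B] by simp
qed

lemma restrict_eq_iff: "restrict f A = restrict g A \<longleftrightarrow> (\<forall>x\<in>A. f x = g x)"
  by (auto simp: restrict_def fun_eq_iff)

context simplicial_chains
begin

section \<open>Simplices of the composite with \<open>HA\<close> as tuples of chains\<close>

abbreviation Y :: "nat \<Rightarrow> (('x \<times> nat) set \<times> (nat \<Rightarrow> 'a)) set psset" where
  "Y k \<equiv> compose_psset (EM A) (smash_fin X k)"

lemma simp_smash_fin: "simp (smash_fin X k) n = smash (simp X n) (fin_pset k)"
  by (simp add: smash_fin_def smash_psset_def const_psset_def)

lemma face_smash_fin: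
  "face (smash_fin X k) (Suc n) i = smash_map (simp X n) (fin_pset k) (face X (Suc n) i) id"
  by (simp add: smash_fin_def smash_psset_def const_psset_def)

lemma simp_Y: "simp (Y k) n = ext_obj (EM A) (smash (simp X n) (fin_pset k))"
  by (simp add: compose_psset_def simp_smash_fin)

lemma component_eq_slice:
  "component n X A k j u = slice j (coefficient A (smash (simp X n) (fin_pset k)) u)"
  by (simp add: component_def slice_def simp_smash_fin)

lemma components_bij:
  "bij_betw (\<lambda>u. \<lambda>j\<in>{1..k}. component n X A k j u) (carrier (simp (Y k) n))
    ({1..k} \<rightarrow>\<^sub>E carrier (chain_group n X A))"
  using bij_betw_trans[OF A.coefficient_bij[OF smash_pointed] A.slices_bij]
  by (simp add: simp_Y component_eq_slice comp_def chain_group_eq_reduced_chains)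

lemma coefficient_closed:
  "u \<in> carrier (simp (Y k) n) \<Longrightarrow>
    coefficient A (smash (simp X n) (fin_pset k)) u \<in>
      carrier (reduced_chains A (smash (simp X n) (fin_pset k)))"
  using bij_betwE[OF A.coefficient_bij[OF smash_pointed]] unfolding simp_Y by blast

lemma component_closed:
  assumes "u \<in> carrier (simp (Y k) n)" "j \<in> {1..k}"
  shows "component n X A k j u \<in> carrier (chain_group n X A)"
  unfolding component_eq_slice chain_group_eq_reduced_chains
  using A.slice_closed[OF coefficient_closed[OF assms(1)] assms(2)] .

lemma component_inj:
  assumes "u \<in> carrier (simp (Y k) n)" "v \<in> carrier (simp (Y k) n)"
    and "\<And>j. j \<in> {1..k} \<Longrightarrow> component n X A k j u = component n X A k j v"
  shows "u = v"
  using inj_onD[OF bij_betw_imp_inj_on[OF components_bij] _ assms(1,2)] assms(3)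
  by (simp add: restrict_eq_iff)

lemma component_surj:
  assumes "\<And>j. j \<in> {1..k} \<Longrightarrow> m j \<in> carrier (chain_group n X A)"
  obtains u where "u \<in> carrier (simp (Y k) n)"
    "\<And>j. j \<in> {1..k} \<Longrightarrow> component n X A k j u = m j"
proof -
  have "(\<lambda>j\<in>{1..k}. m j) \<in> {1..k} \<rightarrow>\<^sub>E carrier (chain_group n X A)"
    using assms by (simp only: restrict_PiE_iff) blast
  also have "\<dots> = (\<lambda>u. \<lambda>j\<in>{1..k}. component n X A k j u) ` carrier (simp (Y k) n)"
    by (rule bij_betw_imp_surj_on[OF components_bij, symmetric])
  finally obtain u where u: "u \<in> carrier (simp (Y k) n)"
    "(\<lambda>j\<in>{1..k}. m j) = (\<lambda>j\<in>{1..k}. component n X A k j u)" by (rule imageE)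
  from u(2) have "\<forall>j\<in>{1..k}. m j = component n X A k j u" unfolding restrict_eq_iff .
  with u(1) that show thesis by metis
qed

lemma point_Y: "point (simp (Y k) n) \<in> carrier (simp (Y k) n)"
  unfolding simp_Y by (rule A.coefficient_point(1)[OF smash_pointed])

lemma component_point:
  "component n X A k j (point (simp (Y k) n)) = \<one>\<^bsub>chain_group n X A\<^esub>"
  unfolding component_eq_slice simp_Y A.coefficient_point(2)[OF smash_pointed]
  by (simp add: slice_def reduced_chains_def chain_group_def)

lemma component_face:
  assumes i: "i \<le> Suc n" and u: "u \<in> carrier (simp (Y k) (Suc n))"
  shows "face (Y k) (Suc n) i u \<in> carrier (simp (Y k) n)"
    and "j \<in> {1..k} \<Longrightarrow> component n X A k j (face (Y k) (Suc n) i u) =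
      chain_face A X (Suc n) i (component (Suc n) X A k j u)"
proof -
  let ?\<Phi> = "smash_map (simp X n) (fin_pset k) (face X (Suc n) i) id"
  have \<Phi>: "pointed_map (smash (simp X (Suc n)) (fin_pset k)) (smash (simp X n) (fin_pset k)) ?\<Phi>"
    using face_pointed[OF i] by (rule smash_map_pointed) (simp add: pointed_map_def)
  have face: "face (Y k) (Suc n) i =
      ext_arr (EM A) (smash (simp X (Suc n)) (fin_pset k)) (smash (simp X n) (fin_pset k)) ?\<Phi>"
    by (simp add: compose_psset_def simp_smash_fin face_smash_fin)
  note arr = A.coefficient_arr[OF \<Phi> u[unfolded simp_Y]]
  show "face (Y k) (Suc n) i u \<in> carrier (simp (Y k) n)"
    unfolding face simp_Y by (rule arr(1))
  show "component n X A k j (face (Y k) (Suc n) i u) =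
      chain_face A X (Suc n) i (component (Suc n) X A k j u)" if "j \<in> {1..k}"
    unfolding face component_eq_slice arr(2) chain_face_Suc
    by (rule A.slice_push_left[OF coefficient_closed[OF u] face_pointed[OF i] that])
qed

text \<open>Components separate simplices, commute with faces and detect the base point, so the
  vanishing of all faces can be tested on each component.\<close>

lemma Zcomb_iff:
  "u \<in> Zcomb n (Y k) \<longleftrightarrow> u \<in> carrier (simp (Y k) n) \<and>
    (\<forall>j\<in>{1..k}. component n X A k j u \<in> normalized_cycles n)"
proof (cases "u \<in> carrier (simp (Y k) n)")
  case u: True
  show ?thesis
  proof (cases n)
    case 0
    then show ?thesis using u component_closed[OF u] by (simp add: Zcomb_def normalized_cycles_def)
  next
    case (Suc m)
    note u = u[unfolded Suc]
    have "face (Y k) (Suc m) i u = point (simp (Y k) m) \<longleftrightarrow>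
        (\<forall>j\<in>{1..k}. chain_face A X (Suc m) i (component (Suc m) X A k j u) =
          \<one>\<^bsub>chain_group m X A\<^esub>)" (is "?L \<longleftrightarrow> ?R") if i: "i \<le> Suc m" for i
    proof
      assume ?L
      then show ?R using component_face(2)[OF i u] component_point by metis
    next
      assume ?R
      then show ?L
        using component_face[OF i u] component_point point_Y
        by (intro component_inj[of _ k m]) simp_all
    qed
    then show ?thesis using u component_closed[OF u]
      by (auto simp: Suc Zcomb_def normalized_cycles_def)
  qed
qed (simp add: Zcomb_def)

lemma boundaries_eq: "boundaries n X A = bd (Suc n) ` carrier (chain_group (Suc n) X A)"
  unfolding boundaries_def using chain_boundary_eq_bd by simp

text \<open>Witnesses for the components can be chosen independently of each other and then
  assembled by \<open>component_surj\<close>. This reduces the relation to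
  \<open>normalized_homologous_iff\<close> in each component.\<close>

lemma Rcomb_iff:
  assumes u: "u \<in> Zcomb n (Y k)" and v: "v \<in> Zcomb n (Y k)"
  shows "Rcomb n (Y k) u v \<longleftrightarrow>
    (\<forall>j\<in>{1..k}. component n X A k j u \<otimes>\<^bsub>chain_group n X A\<^esub>
      inv\<^bsub>chain_group n X A\<^esub> component n X A k j v \<in> boundaries n X A)"
proof -
  let ?d = "\<lambda>i. chain_face A X (Suc n) i"
  have uc: "u \<in> carrier (simp (Y k) n)" "v \<in> carrier (simp (Y k) n)"
    using u v by (simp_all add: Zcomb_iff)
  define P where "P = (\<lambda>j z. z \<in> carrier (chain_group (Suc n) X A) \<and>
    (\<forall>i<n. ?d i z = \<one>\<^bsub>chain_group n X A\<^esub>) \<and>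
    ?d n z = component n X A k j u \<and> ?d (Suc n) z = component n X A k j v)"
  have "Rcomb n (Y k) u v \<longleftrightarrow> (\<forall>j\<in>{1..k}. \<exists>z. P j z)"
  proof
    assume "Rcomb n (Y k) u v"
    then obtain z where z: "z \<in> carrier (simp (Y k) (Suc n))"
      and zf: "\<And>i. i < n \<Longrightarrow> face (Y k) (Suc n) i z = point (simp (Y k) n)"
      "face (Y k) (Suc n) n z = u" "face (Y k) (Suc n) (Suc n) z = v"
      by (auto simp: Rcomb_def)
    show "\<forall>j\<in>{1..k}. \<exists>z. P j z"
    proof
      fix j assume j: "j \<in> {1..k}"
      have "P j (component (Suc n) X A k j z)"
        unfolding P_def using component_closed[OF z j] component_face(2)[OF _ z j] zf component_point
        by (metis le_Suc_eq less_or_eq_imp_le nat_le_linear)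
      then show "\<exists>z. P j z" by blast
    qed
  next
    assume "\<forall>j\<in>{1..k}. \<exists>z. P j z"
    then obtain z where z: "\<And>j. j \<in> {1..k} \<Longrightarrow> P j (z j)" by metis
    then have "\<And>j. j \<in> {1..k} \<Longrightarrow> z j \<in> carrier (chain_group (Suc n) X A)" by (simp add: P_def)
    then obtain w where w: "w \<in> carrier (simp (Y k) (Suc n))"
      "\<And>j. j \<in> {1..k} \<Longrightarrow> component (Suc n) X A k j w = z j"
      by (rule component_surj[of k z "Suc n"]) blast+
    have face: "component n X A k j (face (Y k) (Suc n) i w) = ?d i (z j)"
      if "i \<le> Suc n" "j \<in> {1..k}" for i j
      using component_face(2)[OF that(1) w(1) that(2)] w(2)[OF that(2)] by simp
    have "face (Y k) (Suc n) i w = point (simp (Y k) n)" if "i < n" for i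
      using that z face component_face(1)[OF _ w(1)] component_point point_Y
      by (intro component_inj[of _ k n]) (simp_all add: P_def)
    moreover have "face (Y k) (Suc n) n w = u" "face (Y k) (Suc n) (Suc n) w = v"
      using z face component_face(1)[OF _ w(1)] uc
      by (intro component_inj[of _ k n]; simp add: P_def)+
    ultimately show "Rcomb n (Y k) u v" using u v w(1) by (auto simp: Rcomb_def)
  qed
  also have "\<dots> \<longleftrightarrow> (\<forall>j\<in>{1..k}. component n X A k j u \<otimes>\<^bsub>chain_group n X A\<^esub>
      inv\<^bsub>chain_group n X A\<^esub> component n X A k j v \<in> boundaries n X A)"
  proof (rule ball_cong[OF refl])
    fix j assume "j \<in> {1..k}"
    then have "component n X A k j u \<in> normalized_cycles n" "component n X A k j v \<in> normalized_cycles n"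
      using u v by (simp_all add: Zcomb_iff)
    from normalized_homologous_iff[OF this] show "(\<exists>z. P j z) \<longleftrightarrow>
        component n X A k j u \<otimes>\<^bsub>chain_group n X A\<^esub>
          inv\<^bsub>chain_group n X A\<^esub> component n X A k j v \<in> boundaries n X A"
      unfolding boundaries_eq P_def by (simp add: Bex_def)
  qed
  finally show ?thesis .
qed

section \<open>Cycles, boundaries and the generated equivalence\<close>

lemma cycles_0: "cycles 0 X A = carrier (chain_group 0 X A)"
  by (simp add: cycles_def)

lemma cycles_Suc:
  "cycles (Suc n) X A = {c \<in> carrier (chain_group (Suc n) X A). bd (Suc n) c = \<one>\<^bsub>chain_group n X A\<^esub>}"
  using chain_boundary_eq_bd by (auto simp: cycles_def)

lemma cycles_subgroup: "subgroup (cycles n X A) (chain_group n X A)"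
proof (cases n)
  case 0
  then show ?thesis by (simp add: cycles_0 group.subgroup_self)
next
  case (Suc m)
  have "cycles (Suc m) X A = kernel (chain_group (Suc m) X A) (chain_group m X A) (bd (Suc m))"
    by (auto simp: cycles_Suc kernel_def)
  then show ?thesis using group_hom.subgroup_kernel[OF bd_group_hom] Suc by simp
qed

lemma boundaries_subgroup: "subgroup (boundaries n X A) (chain_group n X A)"
  unfolding boundaries_eq by (rule group_hom.img_is_subgroup[OF bd_group_hom])

lemma boundaries_le_cycles: "boundaries n X A \<subseteq> cycles n X A"
  by (cases n) (auto simp: boundaries_eq cycles_0 cycles_Suc bd_bd)

lemma normalized_cycles_le_cycles: "normalized_cycles n \<subseteq> cycles n X A"
proof (cases n)
  case 0
  then show ?thesis by (auto simp: normalized_cycles_def cycles_0)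
next
  case (Suc m)
  interpret C: comm_group "chain_group m X A" by simp
  have "bd (Suc m) c = \<one>\<^bsub>chain_group m X A\<^esub>" if "c \<in> normalized_cycles (Suc m)" for c
    unfolding bd_Suc using that by (intro C.finprod_one_eqI) (simp add: normalized_cycles_def)
  then show ?thesis by (auto simp: Suc cycles_Suc normalized_cycles_def)
qed

text \<open>Every homology class of the alternating complex has a normalized representative, which
  will give surjectivity of the canonical map. In degree \<open>0\<close> every chain is
  normalized.\<close>

lemma homologous_normalized_cycle:
  assumes z: "z \<in> cycles n X A"
  obtains c where "c \<in> normalized_cycles n"
    "c \<otimes>\<^bsub>chain_group n X A\<^esub> inv\<^bsub>chain_group n X A\<^esub> z \<in> boundaries n X A"
proof (cases n)
  case 0
  interpret C: comm_group "chain_group n X A" by simp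
  have zc: "z \<in> carrier (chain_group n X A)" using z 0 by (simp add: cycles_0)
  then have "z \<otimes>\<^bsub>chain_group n X A\<^esub> inv\<^bsub>chain_group n X A\<^esub> z \<in> boundaries n X A"
    using subgroup.one_closed[OF boundaries_subgroup] by (simp add: C.r_inv)
  then show ?thesis using that[of z] zc 0 by (simp add: normalized_cycles_def)
next
  case (Suc m)
  interpret C: comm_group "chain_group n X A" by simp
  have zc: "z \<in> carrier (chain_group (Suc m) X A)" "bd (Suc m) z = \<one>\<^bsub>chain_group m X A\<^esub>"
    using z by (simp_all add: Suc cycles_Suc)
  obtain w where w: "w \<in> carrier (chain_group (Suc (Suc m)) X A)"
    "z \<otimes>\<^bsub>chain_group n X A\<^esub> bd (Suc n) w \<in> normalized_cycles n"
    using normalized_cycle_exists[OF zc] zc by (auto simp: normalized_cycles_def Suc)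
  have bw: "bd (Suc n) w \<in> carrier (chain_group n X A)" using w by (simp add: Suc)
  have "z \<otimes>\<^bsub>chain_group n X A\<^esub> bd (Suc n) w \<otimes>\<^bsub>chain_group n X A\<^esub> inv\<^bsub>chain_group n X A\<^esub> z =
      bd (Suc n) w"
    using zc(1) bw by (simp add: Suc[symmetric] C.m_comm[of z] C.m_assoc)
  moreover have "bd (Suc n) w \<in> boundaries n X A" using w(1) by (simp add: boundaries_eq Suc)
  ultimately show ?thesis using that[OF w(2)] by simp
qed

text \<open>On \<open>Zcomb\<close> the relation \<open>Rcomb\<close> is equality of the homology
  classes of all components. Being an equivalence already, it is not enlarged by
  \<open>equivclp\<close>.\<close>

lemma Ecomb_iff:
  "(u, v) \<in> Ecomb n (Y k) \<longleftrightarrow> u \<in> Zcomb n (Y k) \<and> v \<in> Zcomb n (Y k) \<and>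
    (\<forall>j\<in>{1..k}. boundaries n X A #>\<^bsub>chain_group n X A\<^esub> component n X A k j u =
      boundaries n X A #>\<^bsub>chain_group n X A\<^esub> component n X A k j v)"
proof -
  define Q where "Q = (\<lambda>u v. \<forall>j\<in>{1..k}.
    boundaries n X A #>\<^bsub>chain_group n X A\<^esub> component n X A k j u =
    boundaries n X A #>\<^bsub>chain_group n X A\<^esub> component n X A k j v)"
  have R: "Rcomb n (Y k) u v \<longleftrightarrow> u \<in> Zcomb n (Y k) \<and> v \<in> Zcomb n (Y k) \<and> Q u v" for u v
  proof (cases "u \<in> Zcomb n (Y k) \<and> v \<in> Zcomb n (Y k)")
    case True
    then have "component n X A k j u \<in> carrier (chain_group n X A)"
      "component n X A k j v \<in> carrier (chain_group n X A)" if "j \<in> {1..k}" for j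
      using component_closed[OF _ that] by (simp_all add: Zcomb_iff)
    with True show ?thesis
      by (simp add: Rcomb_iff Q_def group.rcos_eq_iff[OF group boundaries_subgroup])
  qed (auto simp: Rcomb_def)
  \<comment> \<open>Outside \<open>Zcomb\<close> the closure \<open>equivclp\<close> still relates
    an element to itself, so membership of the starting point has to be a premise that the induction
    carries along.\<close>
  have to_Q: "u \<in> Zcomb n (Y k) \<longrightarrow> v \<in> Zcomb n (Y k) \<and> Q u v" if "equivclp (Rcomb n (Y k)) u v"
    using that
  proof (induction rule: equivclp_induct)
    case base
    show ?case by (simp add: Q_def)
  next
    case (step v w)
    then show ?case by (auto simp: R Q_def)
  qed
  have "(u, v) \<in> Ecomb n (Y k) \<longleftrightarrow> u \<in> Zcomb n (Y k) \<and> v \<in> Zcomb n (Y k) \<and> Q u v"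
  proof
    assume "(u, v) \<in> Ecomb n (Y k)"
    then show "u \<in> Zcomb n (Y k) \<and> v \<in> Zcomb n (Y k) \<and> Q u v"
      using to_Q by (simp add: Ecomb_def)
  next
    assume uv: "u \<in> Zcomb n (Y k) \<and> v \<in> Zcomb n (Y k) \<and> Q u v"
    then have "Rcomb n (Y k) u v" by (simp only: R)
    then have "equivclp (Rcomb n (Y k)) u v" by (rule r_into_equivclp)
    with uv show "(u, v) \<in> Ecomb n (Y k)" by (simp add: Ecomb_def)
  qed
  then show ?thesis unfolding Q_def .
qed

text \<open>Arrows of \<open>HA\<close> multiply components along fibres; faces are homomorphisms,
  so such products remain normalized.\<close>

lemma normalized_cycles_finprod:
  assumes "f \<in> I \<rightarrow> normalized_cycles n"
  shows "finprod (chain_group n X A) f I \<in> normalized_cycles n"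
proof -
  interpret C: comm_group "chain_group n X A" by simp
  have f: "f \<in> I \<rightarrow> carrier (chain_group n X A)" using assms by (auto simp: normalized_cycles_def)
  have "chain_face A X n i (finprod (chain_group n X A) f I) = \<one>\<^bsub>chain_group (n - 1) X A\<^esub>"
    if "n = Suc m" "i \<le> n" for m i
  proof -
    interpret C': comm_group "chain_group m X A" by simp
    have "chain_face A X (Suc m) i (finprod (chain_group (Suc m) X A) f I) =
        finprod (chain_group m X A) (\<lambda>a. chain_face A X (Suc m) i (f a)) I"
      using that f by (intro comm_group_hom_finprod[OF _ _ d_hom]) simp_all
    also have "\<dots> = \<one>\<^bsub>chain_group m X A\<^esub>"
    proof (rule C'.finprod_one_eqI)
      fix a assume "a \<in> I"
      then have "f a \<in> normalized_cycles n" using assms by blast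
      then show "chain_face A X (Suc m) i (f a) = \<one>\<^bsub>chain_group m X A\<^esub>"
        using that by (simp add: normalized_cycles_def)
    qed
    finally show ?thesis by (simp add: that(1))
  qed
  with C.finprod_closed[OF f] show ?thesis by (cases n) (simp_all add: normalized_cycles_def)
qed

section \<open>The homology group as a quotient of the cycles\<close>

abbreviation cycle_group :: "nat \<Rightarrow> ('x \<Rightarrow> 'a) monoid" where
  "cycle_group n \<equiv> (chain_group n X A)\<lparr>carrier := cycles n X A\<rparr>"

abbreviation homology_class :: "nat \<Rightarrow> ('x \<Rightarrow> 'a) \<Rightarrow> ('x \<Rightarrow> 'a) set" where
  "homology_class n z \<equiv> boundaries n X A #>\<^bsub>chain_group n X A\<^esub> z"

lemma cycle_group_comm_group: "comm_group (cycle_group n)"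
proof (rule group.group_comm_groupI)
  interpret C: comm_group "chain_group n X A" by simp
  show "Group.group (cycle_group n)" by (rule subgroup.subgroup_is_group[OF cycles_subgroup group])
  fix x y assume "x \<in> carrier (cycle_group n)" "y \<in> carrier (cycle_group n)"
  then have "x \<in> carrier (chain_group n X A)" "y \<in> carrier (chain_group n X A)"
    using subgroup.subset[OF cycles_subgroup] by auto
  then show "x \<otimes>\<^bsub>cycle_group n\<^esub> y = y \<otimes>\<^bsub>cycle_group n\<^esub> x"
    by (simp add: C.m_comm)
qed

lemma boundaries_normal: "boundaries n X A \<lhd> cycle_group n"
  using comm_group.normal_iff_subgroup[OF cycle_group_comm_group]
    group.subgroup_incl[OF group boundaries_subgroup cycles_subgroup boundaries_le_cycles] by blast

lemma reduced_homology_comm_group: "comm_group (reduced_homology n X A)"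
  unfolding reduced_homology_def
  using comm_group.abelian_FactGroup[OF cycle_group_comm_group] normal_imp_subgroup[OF boundaries_normal]
  by blast

lemma homology_class_hom: "homology_class n \<in> hom (cycle_group n) (reduced_homology n X A)"
  using normal.r_coset_hom_Mod[OF boundaries_normal] by (simp add: reduced_homology_def)

lemma carrier_reduced_homology: "carrier (reduced_homology n X A) = homology_class n ` cycles n X A"
  by (simp add: reduced_homology_def carrier_FactGroup)

lemma homology_class_one:
  "homology_class n \<one>\<^bsub>chain_group n X A\<^esub> = \<one>\<^bsub>reduced_homology n X A\<^esub>"
  using group.coset_mult_one[OF group subgroup.subset[OF boundaries_subgroup]]
  by (simp add: reduced_homology_def)

lemma homology_class_finprod:
  assumes f: "f \<in> I \<rightarrow> cycles n X A"
  shows "homology_class n (finprod (chain_group n X A) f I) =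
    finprod (reduced_homology n X A) (\<lambda>i. homology_class n (f i)) I"
proof -
  have f': "f \<in> I \<rightarrow> carrier (cycle_group n)" using f by simp
  \<comment> \<open>The quotient map starts at the group of cycles, so the product is first moved
    there from the chain group along the inclusion.\<close>
  have "(\<lambda>z. z) \<in> hom (cycle_group n) (chain_group n X A)"
    using subgroup.subset[OF cycles_subgroup] by (auto simp: hom_def)
  from comm_group_hom_finprod[OF cycle_group_comm_group _ this f']
  have "finprod (cycle_group n) f I = finprod (chain_group n X A) f I" by simp
  with comm_group_hom_finprod[OF cycle_group_comm_group reduced_homology_comm_group
      homology_class_hom f']
  show ?thesis by simp
qed

section \<open>The canonical map on classes\<close>

lemma component_normalized:
  "\<lbrakk>u \<in> Zcomb n (Y k); j \<in> {1..k}\<rbrakk> \<Longrightarrow> component n X A k j u \<in> normalized_cycles n"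
  by (simp add: Zcomb_iff)

lemma component_cycle:
  "\<lbrakk>u \<in> Zcomb n (Y k); j \<in> {1..k}\<rbrakk> \<Longrightarrow> component n X A k j u \<in> cycles n X A"
  using component_normalized normalized_cycles_le_cycles by blast

lemma Zcomb_point: "point (simp (Y k) n) \<in> Zcomb n (Y k)"
  unfolding Zcomb_iff component_point
  using point_Y by (cases n) (simp_all add: normalized_cycles_def)

lemma Ecomb_refl: "u \<in> Zcomb n (Y k) \<Longrightarrow> (u, u) \<in> Ecomb n (Y k)"
  by (simp add: Ecomb_iff)

lemma Ecomb_equiv: "equiv (Zcomb n (Y k)) (Ecomb n (Y k))"
  by (rule equivI) (auto simp: refl_on_def sym_def trans_def Ecomb_iff)

lemma pi_comb_classI: "u \<in> Zcomb n (Y k) \<Longrightarrow> Ecomb n (Y k) `` {u} \<in> carrier (pi_comb n (Y k))"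
  by (simp add: pi_comb_def quotientI)

lemma pi_comb_cases:
  assumes "c \<in> carrier (pi_comb n (Y k))"
  obtains u where "u \<in> Zcomb n (Y k)" "c = Ecomb n (Y k) `` {u}"
  using assms by (auto simp: pi_comb_def elim: quotientE)

text \<open>The product in the definition is the union of the cosets of all representatives. By
  \<open>Ecomb_iff\<close> these cosets coincide, and the union is not empty since \<open>u\<close>
  represents its own class.\<close>

lemma canonical_map_class:
  assumes u: "u \<in> Zcomb n (Y k)"
  shows "canonical_map n X A k (Ecomb n (Y k) `` {u}) =
    (\<lambda>j\<in>{1..k}. homology_class n (component n X A k j u))"
  unfolding canonical_map_def
proof (rule restrict_ext)
  fix j assume j: "j \<in> {1..k}"
  have "boundaries n X A <#>\<^bsub>chain_group n X A\<^esub> (component n X A k j ` (Ecomb n (Y k) `` {u})) =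
      (\<Union>v\<in>Ecomb n (Y k) `` {u}. homology_class n (component n X A k j v))"
    by (auto simp: set_mult_def r_coset_def)
  also have "\<dots> = (\<Union>v\<in>Ecomb n (Y k) `` {u}. homology_class n (component n X A k j u))"
    using j by (intro SUP_cong) (simp_all add: Ecomb_iff)
  also have "\<dots> = homology_class n (component n X A k j u)"
    using Ecomb_refl[OF u] by auto
  finally show "boundaries n X A <#>\<^bsub>chain_group n X A\<^esub>
      (component n X A k j ` (Ecomb n (Y k) `` {u})) = homology_class n (component n X A k j u)" .
qed

text \<open>Injectivity is \<open>Ecomb_iff\<close>. For surjectivity, each of the \<open>k\<close>
  homology classes is represented by a normalized cycle, and these are the components of one element
  of \<open>Zcomb\<close>.\<close>

lemma canonical_map_bij:
  "bij_betw (canonical_map n X A k) (carrier (pi_comb n (Y k)))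
    ({1..k} \<rightarrow>\<^sub>E carrier (reduced_homology n X A))"
proof (rule bij_betwI')
  fix b c assume "b \<in> carrier (pi_comb n (Y k))" "c \<in> carrier (pi_comb n (Y k))"
  then obtain u v where u: "u \<in> Zcomb n (Y k)" "b = Ecomb n (Y k) `` {u}"
    and v: "v \<in> Zcomb n (Y k)" "c = Ecomb n (Y k) `` {v}"
    by (metis pi_comb_cases)
  have "b = c \<longleftrightarrow> (u, v) \<in> Ecomb n (Y k)"
    using eq_equiv_class_iff[OF Ecomb_equiv u(1) v(1)] u v by simp
  then show "canonical_map n X A k b = canonical_map n X A k c \<longleftrightarrow> b = c"
    using u v by (simp add: canonical_map_class restrict_eq_iff Ecomb_iff)
next
  fix c assume "c \<in> carrier (pi_comb n (Y k))"
  then obtain u where u: "u \<in> Zcomb n (Y k)" "c = Ecomb n (Y k) `` {u}" by (rule pi_comb_cases)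
  show "canonical_map n X A k c \<in> {1..k} \<rightarrow>\<^sub>E carrier (reduced_homology n X A)"
    unfolding u(2) canonical_map_class[OF u(1)] restrict_PiE_iff carrier_reduced_homology
    using component_cycle[OF u(1)] by blast
next
  fix w assume w: "w \<in> {1..k} \<rightarrow>\<^sub>E carrier (reduced_homology n X A)"
  have "\<exists>z. z \<in> normalized_cycles n \<and> homology_class n z = w j" if j: "j \<in> {1..k}" for j
  proof -
    obtain z where z: "z \<in> cycles n X A" "w j = homology_class n z"
      using PiE_mem[OF w j] unfolding carrier_reduced_homology by blast
    obtain c where c: "c \<in> normalized_cycles n"
      "c \<otimes>\<^bsub>chain_group n X A\<^esub> inv\<^bsub>chain_group n X A\<^esub> z \<in> boundaries n X A"
      using homologous_normalized_cycle[OF z(1)] .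
    have "c \<in> carrier (chain_group n X A)" "z \<in> carrier (chain_group n X A)"
      using c(1) z(1) subgroup.subset[OF cycles_subgroup] by (auto simp: normalized_cycles_def)
    then have "homology_class n c = homology_class n z"
      using c(2) group.rcos_eq_iff[OF group boundaries_subgroup] by blast
    with c(1) z(2) show ?thesis by metis
  qed
  then obtain z where z: "\<And>j. j \<in> {1..k} \<Longrightarrow> z j \<in> normalized_cycles n"
    "\<And>j. j \<in> {1..k} \<Longrightarrow> homology_class n (z j) = w j" by metis
  have "\<And>j. j \<in> {1..k} \<Longrightarrow> z j \<in> carrier (chain_group n X A)"
    using z(1) by (simp add: normalized_cycles_def)
  then obtain u where u: "u \<in> carrier (simp (Y k) n)"
    "\<And>j. j \<in> {1..k} \<Longrightarrow> component n X A k j u = z j"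
    by (rule component_surj[of k z n]) blast+
  have uZ: "u \<in> Zcomb n (Y k)" using u z(1) by (simp add: Zcomb_iff)
  have "w = canonical_map n X A k (Ecomb n (Y k) `` {u})"
    unfolding canonical_map_class[OF uZ]
  proof (rule PiE_ext[OF w])
    show "(\<lambda>j\<in>{1..k}. homology_class n (component n X A k j u)) \<in>
        {1..k} \<rightarrow>\<^sub>E carrier (reduced_homology n X A)"
      unfolding restrict_PiE_iff carrier_reduced_homology using component_cycle[OF uZ] by blast
    show "w j = (\<lambda>j\<in>{1..k}. homology_class n (component n X A k j u)) j" if "j \<in> {1..k}" for j
      using that u(2) z(2) by simp
  qed
  with pi_comb_classI[OF uZ] show "\<exists>c\<in>carrier (pi_comb n (Y k)). w = canonical_map n X A k c" by blast
qed

lemma canonical_map_point: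
  "canonical_map n X A k (point (pi_comb n (Y k))) = (\<lambda>j\<in>{1..k}. \<one>\<^bsub>reduced_homology n X A\<^esub>)"
  using canonical_map_class[OF Zcomb_point]
  by (simp add: pi_comb_def component_point homology_class_one)

section \<open>Naturality in the finite pointed set\<close>

abbreviation Y_map :: "nat \<Rightarrow> nat \<Rightarrow> nat \<Rightarrow> (nat \<Rightarrow> nat) \<Rightarrow>
    (('x \<times> nat) set \<times> (nat \<Rightarrow> 'a)) set \<Rightarrow> (('x \<times> nat) set \<times> (nat \<Rightarrow> 'a)) set" where
  "Y_map n k l f \<equiv> ext_arr (EM A) (simp (smash_fin X k) n) (simp (smash_fin X l) n)
    (smash_map (simp X n) (fin_pset l) id f)"

lemma component_Y_map:
  assumes f: "pointed_map (fin_pset k) (fin_pset l) f" and u: "u \<in> carrier (simp (Y k) n)"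
  shows "Y_map n k l f u \<in> carrier (simp (Y l) n)"
    and "j \<in> {1..l} \<Longrightarrow> component n X A l j (Y_map n k l f u) =
      (\<Otimes>\<^bsub>chain_group n X A\<^esub>i\<in>{i \<in> {1..k}. f i = j}. component n X A k i u)"
proof -
  let ?\<Phi> = "smash_map (simp X n) (fin_pset l) id f"
  have \<Phi>: "pointed_map (smash (simp X n) (fin_pset k)) (smash (simp X n) (fin_pset l)) ?\<Phi>"
    using f by (intro smash_map_pointed) (simp add: pointed_map_def)
  note arr = A.coefficient_arr[OF \<Phi> u[unfolded simp_Y]]
  show "Y_map n k l f u \<in> carrier (simp (Y l) n)"
    unfolding simp_Y simp_smash_fin by (rule arr(1))
  assume j: "j \<in> {1..l}"
  have "component n X A l j (Y_map n k l f u) =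
      (\<lambda>x. \<Otimes>\<^bsub>A\<^esub>i\<in>{i \<in> {1..k}. f i = j}. component n X A k i u x)"
    unfolding component_eq_slice simp_smash_fin arr(2)
    by (rule A.slice_push_right[OF simp_pointed coefficient_closed[OF u] f j])
  also have "\<dots> = (\<Otimes>\<^bsub>chain_group n X A\<^esub>i\<in>{i \<in> {1..k}. f i = j}. component n X A k i u)"
    using component_closed[OF u] unfolding chain_group_eq_reduced_chains
    by (intro ext A.reduced_chains_finprod[symmetric] funcsetI) simp
  finally show "component n X A l j (Y_map n k l f u) =
      (\<Otimes>\<^bsub>chain_group n X A\<^esub>i\<in>{i \<in> {1..k}. f i = j}. component n X A k i u)" .
qed

lemma Y_map_Zcomb:
  assumes f: "pointed_map (fin_pset k) (fin_pset l) f" and u: "u \<in> Zcomb n (Y k)"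
  shows "Y_map n k l f u \<in> Zcomb n (Y l)"
    and "j \<in> {1..l} \<Longrightarrow> homology_class n (component n X A l j (Y_map n k l f u)) =
      (\<Otimes>\<^bsub>reduced_homology n X A\<^esub>i\<in>{i \<in> {1..k}. f i = j}. homology_class n (component n X A k i u))"
proof -
  have uc: "u \<in> carrier (simp (Y k) n)" using u by (simp add: Zcomb_iff)
  show "Y_map n k l f u \<in> Zcomb n (Y l)"
    unfolding Zcomb_iff
  proof (intro conjI ballI)
    fix j assume "j \<in> {1..l}"
    then show "component n X A l j (Y_map n k l f u) \<in> normalized_cycles n"
      using component_normalized[OF u]
      by (simp only: component_Y_map[OF f uc]) (intro normalized_cycles_finprod funcsetI, simp)
  qed (rule component_Y_map(1)[OF f uc])
  assume "j \<in> {1..l}"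
  then show "homology_class n (component n X A l j (Y_map n k l f u)) =
      (\<Otimes>\<^bsub>reduced_homology n X A\<^esub>i\<in>{i \<in> {1..k}. f i = j}. homology_class n (component n X A k i u))"
    using component_cycle[OF u]
    by (simp only: component_Y_map[OF f uc]) (intro homology_class_finprod funcsetI, simp)
qed

text \<open>Equivalent elements have components with the same homology classes, and
  \<open>Y_map\<close> combines these by products in the homology group; so the image of a class
  lies in one class.\<close>

lemma pi_comb_map_class:
  assumes f: "pointed_map (fin_pset k) (fin_pset l) f" and u: "u \<in> Zcomb n (Y k)"
  shows "pi_comb_map n (Y l) (Y_map n k l f) (Ecomb n (Y k) `` {u}) = Ecomb n (Y l) `` {Y_map n k l f u}"
proof -
  have "(Y_map n k l f u, Y_map n k l f v) \<in> Ecomb n (Y l)" if uv: "(u, v) \<in> Ecomb n (Y k)" for v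
  proof -
    have v: "v \<in> Zcomb n (Y k)" using uv by (simp add: Ecomb_iff)
    interpret H: comm_group "reduced_homology n X A" by (rule reduced_homology_comm_group)
    have mem: "homology_class n (component n X A k i v) \<in> carrier (reduced_homology n X A)"
      if "i \<in> {1..k}" for i
      unfolding carrier_reduced_homology using component_cycle[OF v that] by blast
    have "homology_class n (component n X A l j (Y_map n k l f u)) =
        homology_class n (component n X A l j (Y_map n k l f v))" if "j \<in> {1..l}" for j
      unfolding Y_map_Zcomb(2)[OF f u that] Y_map_Zcomb(2)[OF f v that]
      using uv mem by (intro H.finprod_cong') (simp_all add: Ecomb_iff)
    then show ?thesis unfolding Ecomb_iff using Y_map_Zcomb(1)[OF f] u v by blast
  qed
  then have "Ecomb n (Y l) `` {Y_map n k l f v} = Ecomb n (Y l) `` {Y_map n k l f u}"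
    if "v \<in> Ecomb n (Y k) `` {u}" for v
    using that equiv_class_eq[OF Ecomb_equiv] by blast
  moreover have "u \<in> Ecomb n (Y k) `` {u}" using Ecomb_refl[OF u] by simp
  ultimately show ?thesis unfolding pi_comb_map_def by blast
qed

lemma gamma_homology_EM_iso:
  "gamma_iso (gamma_homology n X (EM A)) (EM (reduced_homology n X A)) (canonical_map n X A)"
proof (rule gamma_isoI)
  interpret H: comm_group "reduced_homology n X A" by (rule reduced_homology_comm_group)
  let ?M = "gamma_homology n X (EM A)" and ?N = "EM (reduced_homology n X A)"
  have objM: "obj ?M k = pi_comb n (Y k)" for k by (simp add: gamma_homology_def)
  have arrM: "arr ?M k l f = pi_comb_map n (Y l) (Y_map n k l f)" for k l f
    by (simp add: gamma_homology_def)
  have carrN: "carrier (obj ?N k) = {1..k} \<rightarrow>\<^sub>E carrier (reduced_homology n X A)" for k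
    by (simp add: EM_def)
  have ptN: "point (obj ?N k) = (\<lambda>j\<in>{1..k}. \<one>\<^bsub>reduced_homology n X A\<^esub>)" for k
    by (simp add: EM_def)
  have ptM: "point (pi_comb n (Y k)) = Ecomb n (Y k) `` {point (simp (Y k) n)}" for k
    by (simp add: pi_comb_def)
  show "gamma_set ?N" by (rule EM_gamma_set[OF H.comm_monoid_axioms])
  show "pointed_set (obj ?M k)" for k
    unfolding objM pointed_set_def ptM by (rule pi_comb_classI[OF Zcomb_point])
  show bij: "bij_betw (canonical_map n X A k) (carrier (obj ?M k)) (carrier (obj ?N k))" for k
    unfolding objM carrN by (rule canonical_map_bij)
  show "pointed_map (obj ?M k) (obj ?N k) (canonical_map n X A k)" for k
    using bij_betwE[OF bij[of k]] canonical_map_point[of n k]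
    unfolding pointed_map_def objM ptN by blast
  fix k l f assume f: "pointed_map (fin_pset k) (fin_pset l) f"
  show "pointed_map (obj ?M k) (obj ?M l) (arr ?M k l f)"
    unfolding pointed_map_def objM arrM
  proof (intro conjI funcsetI)
    fix c assume "c \<in> carrier (pi_comb n (Y k))"
    then obtain u where u: "u \<in> Zcomb n (Y k)" "c = Ecomb n (Y k) `` {u}" by (rule pi_comb_cases)
    show "pi_comb_map n (Y l) (Y_map n k l f) c \<in> carrier (pi_comb n (Y l))"
      unfolding u(2) pi_comb_map_class[OF f u(1)] by (rule pi_comb_classI[OF Y_map_Zcomb(1)[OF f u(1)]])
  next
    \<comment> \<open>The components of the base point are units, and so are their products;
      \<open>component_inj\<close> then shows that \<open>Y_map\<close> preserves the base
      point.\<close>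
    have "component n X A l j (Y_map n k l f (point (simp (Y k) n))) =
        component n X A l j (point (simp (Y l) n))" if "j \<in> {1..l}" for j
    proof -
      interpret C: comm_group "chain_group n X A" by simp
      show ?thesis unfolding component_Y_map(2)[OF f point_Y that] component_point by simp
    qed
    then have "Y_map n k l f (point (simp (Y k) n)) = point (simp (Y l) n)"
      using component_Y_map(1)[OF f point_Y] point_Y by (intro component_inj[of _ l n])
    then show "pi_comb_map n (Y l) (Y_map n k l f) (point (pi_comb n (Y k))) = point (pi_comb n (Y l))"
      unfolding ptM pi_comb_map_class[OF f Zcomb_point] by simp
  qed
  fix c assume "c \<in> carrier (obj ?M k)"
  then obtain u where u: "u \<in> Zcomb n (Y k)" "c = Ecomb n (Y k) `` {u}"
    unfolding objM by (rule pi_comb_cases)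
  have mem: "homology_class n (component n X A k i u) \<in> carrier (reduced_homology n X A)"
    if "i \<in> {1..k}" for i
    unfolding carrier_reduced_homology using component_cycle[OF u(1) that] by blast
  have "canonical_map n X A l (arr ?M k l f c) =
      (\<lambda>j\<in>{1..l}. homology_class n (component n X A l j (Y_map n k l f u)))"
    unfolding arrM u(2) pi_comb_map_class[OF f u(1)] by (rule canonical_map_class[OF Y_map_Zcomb(1)[OF f u(1)]])
  \<comment> \<open>The fibre products of homology classes are exactly the arrow of
    \<open>EM\<close> for the homology group, applied to the tuple of classes.\<close>
  also have "\<dots> = (\<lambda>j\<in>{1..l}. \<Otimes>\<^bsub>reduced_homology n X A\<^esub>i\<in>{i \<in> {1..k}. f i = j}. canonical_map n X A k c i)"
  proof (rule restrict_ext)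
    fix j assume j: "j \<in> {1..l}"
    show "homology_class n (component n X A l j (Y_map n k l f u)) =
        (\<Otimes>\<^bsub>reduced_homology n X A\<^esub>i\<in>{i \<in> {1..k}. f i = j}. canonical_map n X A k c i)"
      unfolding Y_map_Zcomb(2)[OF f u(1) j] u(2) canonical_map_class[OF u(1)]
      using mem by (intro H.finprod_cong') simp_all
  qed
  also have "\<dots> = arr ?N k l f (canonical_map n X A k c)" by (simp add: EM_def)
  finally show "canonical_map n X A l (arr ?M k l f c) = arr ?N k l f (canonical_map n X A k c)" .
qed

end

theorem theorem1p3:
  fixes A :: "('a, 'b) monoid_scheme"
    and X :: "'x psset"
    and n :: nat
  assumes "comm_group A"
    and "pointed_simplicial_set X"
  shows "gamma_iso (gamma_homology n X (EM A)) (EM (reduced_homology n X A)) (canonical_map n X A)"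
proof -
  interpret simplicial_chains A X using assms by (simp add: simplicial_chains_def)
  show ?thesis by (rule gamma_homology_EM_iso)
qed

end
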